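(* Let $M$ be a properly immersed translator in $\mathbb{H}^2\times\mathbb{R}$ with (possibly empty) compact boundary. Suppose that its vertical asymptotic boundary $\partial_\infty^vM$ is a proper family of disjoint immersed continuous curves, and let $\gamma$ be a connected component of $\partial_\infty^vM$ so that $M\cup\gamma$ is a continuous surface with boundary. Then there is $p\in\partial_\infty\mathbb{H}^2$ such that either $\gamma=\{p\}\times\mathbb{R}$, or $\gamma=\{p\}\times[T,\infty)$ for some $T\in\mathbb{R}$.
   Context: Translators. $\mathbb{H}^2$ is the hyperbolic plane with ideal boundary $\partial_\infty\mathbb{H}^2$, and $\mathbb{H}^2\times\mathbb{R}$ carries the product metric; $\partial_h$ is the unit coordinate vector field of the factor $\mathbb{R}$. A translator is an immersed surface $M$ (here possibly with boundary $\partial M$) in $\mathbb{H}^2\times\mathbb{R}$ satisfying $H=\langle N,\partial_h\rangle$, where $N$ is the unit normal and $H$ the mean curvature with respect to $N$, i.e. the mean curvature vector (trace of the second fundamental form) is $\vec H=HN$. Asymptotic boundary. The boundary at infinity of $\mathbb{H}^2\times\mathbb{R}$ is $\partial_\infty(\mathbb{H}^2\times\mathbb{R})=[\partial_\infty\mathbb{H}^2\times\mathbb{R}]\cup[\mathbb{H}^2\times\{\pm\infty\}]\cup[\partial_\infty\mathbb{H}^2\times\{\pm\infty\}]$. A sequence $p_n=(x_n,t_n)$ in $\mathbb{H}^2\times\mathbb{R}$ converges to $(x,t)\in\partial_\infty(\mathbb{H}^2\times\mathbb{R})$ if $x_n\to x$ in $\mathbb{H}^2\cup\partial_\infty\mathbb{H}^2$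 (Euclidean convergence in the closed Poincaré disc) and $t_n\to t$ in $[-\infty,+\infty]$. For $A\subset\mathbb{H}^2\times\mathbb{R}$, the asymptotic boundary $\partial_\infty A$ is the set of points of $\partial_\infty(\mathbb{H}^2\times\mathbb{R})$ that are limits of sequences of points of $A$. Its vertical part is $\partial_\infty^vA=\partial_\infty A\cap(\partial_\infty\mathbb{H}^2\times\mathbb{R})$. Conventions. A family of curves in $\partial_\infty\mathbb{H}^2\times\mathbb{R}$ is proper if it is locally finite, i.e. every compact subset of $\partial_\infty\mathbb{H}^2\times\mathbb{R}$ meets only finitely many curves of the family. That $M\cup\gamma$ is a continuous surface with boundary is meant with respect to the topology of the compactification just described, with $\gamma$ being boundary. *)

theory Defs
  imports "HOL-Analysis.Analysis"
begin

section \<open>Surfaces with boundary\<close>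

definition half_plane :: "(real \<times> real) set" where
  "half_plane = {u. 0 \<le> snd u}"

definition surface_chart :: "'a topology \<Rightarrow> 'a set \<Rightarrow> ('a \<Rightarrow> real \<times> real) \<Rightarrow> bool" where
  "surface_chart S U \<phi> \<longleftrightarrow>
     openin S U \<and> openin (top_of_set half_plane) (\<phi> ` U) \<and>
     homeomorphic_map (subtopology S U) (top_of_set (\<phi> ` U)) \<phi>"

definition topological_surface :: "'a topology \<Rightarrow> bool" where
  "topological_surface S \<longleftrightarrow>
     Hausdorff_space S \<and> second_countable S \<and>
     (\<forall>x\<in>topspace S. \<exists>U \<phi>. surface_chart S U \<phi> \<and> x \<in> U)"

definition surface_boundary :: "'a topology \<Rightarrow> 'a set" where
  "surface_boundary S =
     {x \<in> topspace S. \<exists>U \<phi>. surface_chart S U \<phi> \<and> x \<in> U \<and> snd (\<phi> x) = 0}"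

text \<open>The derivatives are taken within \<open>D\<close>; they are unique when \<open>D\<close> is relatively open in
  \<open>half_plane\<close>, being one-sided on the boundary line. The predicate is only used for such \<open>D\<close>.\<close>

primrec Ck_on :: "nat \<Rightarrow> (real \<times> real \<Rightarrow> 'b::real_normed_vector) \<Rightarrow> (real \<times> real) set \<Rightarrow> bool" where
  "Ck_on 0 f D \<longleftrightarrow> continuous_on D f"
| "Ck_on (Suc k) f D \<longleftrightarrow>
     f differentiable_on D \<and>
     (\<forall>v. Ck_on k (\<lambda>u. frechet_derivative f (at u within D) v) D)"

definition smooth_on :: "(real \<times> real \<Rightarrow> 'b::real_normed_vector) \<Rightarrow> (real \<times> real) set \<Rightarrow> bool" where
  "smooth_on f D \<longleftrightarrow> (\<forall>k. Ck_on k f D)"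

type_synonym 'a atlas = "('a set \<times> ('a \<Rightarrow> real \<times> real)) set"

definition smooth_surface :: "'a topology \<Rightarrow> 'a atlas \<Rightarrow> bool" where
  "smooth_surface S A \<longleftrightarrow>
     topological_surface S \<and>
     (\<forall>(U, \<phi>)\<in>A. surface_chart S U \<phi>) \<and>
     (\<Union>(U, \<phi>)\<in>A. U) = topspace S \<and>
     (\<forall>(U, \<phi>)\<in>A. \<forall>(V, \<psi>)\<in>A. smooth_on (\<psi> \<circ> inv_into U \<phi>) (\<phi> ` (U \<inter> V)))"

definition smooth_immersion ::
    "'a topology \<Rightarrow> 'a atlas \<Rightarrow> ('a \<Rightarrow> 'b::real_normed_vector) \<Rightarrow> bool" where
  "smooth_immersion S A F \<longleftrightarrow>
     smooth_surface S A \<and>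
     (\<forall>(U, \<phi>)\<in>A. smooth_on (F \<circ> inv_into U \<phi>) (\<phi> ` U) \<and>
        (\<forall>u\<in>\<phi> ` U. inj (frechet_derivative (F \<circ> inv_into U \<phi>) (at u within \<phi> ` U))))"


section \<open>The Riemannian product of the hyperbolic plane and the line\<close>

text \<open>The hyperbolic plane is the open unit disc with metric \<open>4 |dz|\<^sup>2 / (1 - |z|\<^sup>2)\<^sup>2\<close>
  (curvature \<open>-1\<close>).\<close>

definition HxR :: "(complex \<times> real) set" where
  "HxR = ball 0 1 \<times> UNIV"

definition HxR_metric ::
    "complex \<times> real \<Rightarrow> complex \<times> real \<Rightarrow> complex \<times> real \<Rightarrow> real" where
  "HxR_metric p v w =
     (2 / (1 - (norm (fst p))\<^sup>2))\<^sup>2 * (fst v \<bullet> fst w) + snd v * snd w"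

text \<open>The Christoffel tensor of the Levi-Civita connection in the coordinates of
  \<open>complex \<times> real\<close>: for the conformal metric \<open>exp (2 * f) |dz|\<^sup>2\<close> it is
  \<open>df(v) w + df(w) v - (v \<bullet> w) grad f\<close>, here with \<open>f = ln (2 / (1 - |z|\<^sup>2))\<close>. The two lemmas
  below (torsion-freeness and metric compatibility) characterize it.\<close>

definition HxR_christoffel ::
    "complex \<times> real \<Rightarrow> complex \<times> real \<Rightarrow> complex \<times> real \<Rightarrow> complex \<times> real" where
  "HxR_christoffel p v w =
     (let z = fst p; a = fst v; b = fst w
      in ((2 / (1 - (norm z)\<^sup>2)) *\<^sub>R ((z \<bullet> a) *\<^sub>R b + (z \<bullet> b) *\<^sub>R a - (a \<bullet> b) *\<^sub>R z), 0))"

lemma HxR_christoffel_sym: "HxR_christoffel p v w = HxR_christoffel p w v"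
  by (simp add: HxR_christoffel_def Let_def inner_commute add.commute)

lemma HxR_christoffel_metric_compatible:
  assumes "p \<in> HxR"
  shows "((\<lambda>q. HxR_metric q v w) has_derivative
     (\<lambda>u. HxR_metric p (HxR_christoffel p u v) w + HxR_metric p v (HxR_christoffel p u w))) (at p)"
proof -
  have n: "norm (fst p) < 1" using assms by (auto simp: HxR_def)
  have pos: "1 - fst p \<bullet> fst p \<noteq> 0"
    using n by (metis norm_eq_sqrt_inner real_sqrt_lt_1_iff diff_gt_0_iff_gt less_irrefl)
  have eq: "(\<lambda>q. HxR_metric q v w) =
      (\<lambda>q. (2 / (1 - fst q \<bullet> fst q))\<^sup>2 * (fst v \<bullet> fst w) + snd v * snd w)"
    by (simp add: HxR_metric_def power2_norm_eq_inner)
  show ?thesis unfolding eq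
    apply (rule has_derivative_eq_rhs)
     apply (rule derivative_eq_intros refl pos | simp add: pos)+
    apply (rule ext)
    apply (simp add: HxR_metric_def HxR_christoffel_def Let_def power2_norm_eq_inner
        inner_add_left inner_add_right inner_diff_left inner_diff_right)
    using pos
    apply (simp add: inner_commute divide_simps power2_eq_square)
    done
qed


section \<open>Mean curvature and translators\<close>

text \<open>Local formulas for a parametrization \<open>X\<close> with domain \<open>D\<close> and a unit normal \<open>N\<close> at the
  parameter \<open>u\<close>.\<close>

definition partial ::
    "(real \<times> real) set \<Rightarrow> real \<times> real \<Rightarrow> (real \<times> real \<Rightarrow> 'b::real_normed_vector)
      \<Rightarrow> real \<times> real \<Rightarrow> 'b" where
  "partial D e X u = frechet_derivative X (at u within D) e"

definition is_unit_normal ::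
    "(real \<times> real) set \<Rightarrow> (real \<times> real \<Rightarrow> complex \<times> real) \<Rightarrow> real \<times> real
      \<Rightarrow> complex \<times> real \<Rightarrow> bool" where
  "is_unit_normal D X u N \<longleftrightarrow>
     HxR_metric (X u) N N = 1 \<and> (\<forall>e. HxR_metric (X u) (partial D e X u) N = 0)"

definition first_fundamental_form ::
    "(real \<times> real) set \<Rightarrow> (real \<times> real \<Rightarrow> complex \<times> real) \<Rightarrow> real \<times> real
      \<Rightarrow> real \<times> real \<Rightarrow> real \<times> real \<Rightarrow> real" where
  "first_fundamental_form D X u d e = HxR_metric (X u) (partial D d X u) (partial D e X u)"

definition second_fundamental_form ::
    "(real \<times> real) set \<Rightarrow> (real \<times> real \<Rightarrow> complex \<times> real) \<Rightarrow> real \<times> real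
      \<Rightarrow> complex \<times> real \<Rightarrow> real \<times> real \<Rightarrow> real \<times> real \<Rightarrow> real" where
  "second_fundamental_form D X u N d e =
     HxR_metric (X u)
       (partial D d (partial D e X) u
         + HxR_christoffel (X u) (partial D d X u) (partial D e X u)) N"

text \<open>The trace of the second fundamental form with respect to the first (not half of it).\<close>

definition mean_curvature ::
    "(real \<times> real) set \<Rightarrow> (real \<times> real \<Rightarrow> complex \<times> real) \<Rightarrow> real \<times> real
      \<Rightarrow> complex \<times> real \<Rightarrow> real" where
  "mean_curvature D X u N =
     (let g = first_fundamental_form D X u; h = second_fundamental_form D X u N;
          e\<^sub>1 = (1, 0); e\<^sub>2 = (0, 1)
      in (g e\<^sub>2 e\<^sub>2 * h e\<^sub>1 e\<^sub>1 - 2 * g e\<^sub>1 e\<^sub>2 * h e\<^sub>1 e\<^sub>2 + g e\<^sub>1 e\<^sub>1 * h e\<^sub>2 e\<^sub>2)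
         / (g e\<^sub>1 e\<^sub>1 * g e\<^sub>2 e\<^sub>2 - (g e\<^sub>1 e\<^sub>2)\<^sup>2))"

text \<open>The equation is invariant under \<open>N \<mapsto> -N\<close>, so it is imposed for every unit normal at every
  point and no orientation is needed. The vertical field \<open>\<partial>\<^sub>h\<close> is \<open>(0, 1)\<close>.\<close>

definition translator ::
    "'a topology \<Rightarrow> 'a atlas \<Rightarrow> ('a \<Rightarrow> complex \<times> real) \<Rightarrow> bool" where
  "translator S A F \<longleftrightarrow>
     smooth_immersion S A F \<and> F ` topspace S \<subseteq> HxR \<and>
     (\<forall>(U, \<phi>)\<in>A. \<forall>u\<in>\<phi> ` U. \<forall>N.
        is_unit_normal (\<phi> ` U) (F \<circ> inv_into U \<phi>) u N \<longrightarrow>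
        mean_curvature (\<phi> ` U) (F \<circ> inv_into U \<phi>) u N
          = HxR_metric ((F \<circ> inv_into U \<phi>) u) N (0, 1))"

definition properly_immersed_translator ::
    "'a topology \<Rightarrow> 'a atlas \<Rightarrow> ('a \<Rightarrow> complex \<times> real) \<Rightarrow> bool" where
  "properly_immersed_translator S A F \<longleftrightarrow>
     translator S A F \<and> proper_map S (top_of_set HxR) F"


section \<open>Asymptotic boundary\<close>

text \<open>The compactification is the product of the closed unit disc and \<open>[-\<infinity>, \<infinity>]\<close>, with the
  product topology.\<close>

definition ext :: "complex \<times> real \<Rightarrow> complex \<times> ereal" where
  "ext p = (fst p, ereal (snd p))"

definition ideal_points :: "(complex \<times> ereal) set" where
  "ideal_points = (cball 0 1 \<times> UNIV) - ext ` HxR"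

definition asymptotic_boundary :: "(complex \<times> real) set \<Rightarrow> (complex \<times> ereal) set" where
  "asymptotic_boundary M =
     {q \<in> ideal_points. \<exists>p. (\<forall>n::nat. p n \<in> M) \<and> (\<lambda>n. ext (p n)) \<longlonglongrightarrow> q}"

definition vertical_boundary :: "(complex \<times> real) set" where
  "vertical_boundary = sphere 0 1 \<times> UNIV"

definition vertical_asymptotic_boundary ::
    "(complex \<times> real) set \<Rightarrow> (complex \<times> real) set" where
  "vertical_asymptotic_boundary M = {q \<in> vertical_boundary. ext q \<in> asymptotic_boundary M}"

text \<open>The interval may be open, half-open or closed, so curves with end points are admitted;
  closed curves arise as images of periodic maps on the whole line.\<close>

definition immersed_curve :: "(complex \<times> real) set \<Rightarrow> bool" where
  "immersed_curve C \<longleftrightarrow>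
     (\<exists>(I :: real set) c. is_interval I \<and> (\<exists>a\<in>I. \<exists>b\<in>I. a < b) \<and> continuous_on I c \<and>
        (\<forall>s\<in>I. \<exists>\<epsilon>>0. inj_on c (I \<inter> ball s \<epsilon>)) \<and> C = c ` I)"

definition proper_family_of_disjoint_curves :: "(complex \<times> real) set set \<Rightarrow> bool" where
  "proper_family_of_disjoint_curves \<C> \<longleftrightarrow>
     (\<forall>C\<in>\<C>. immersed_curve C \<and> C \<subseteq> vertical_boundary) \<and> disjoint \<C> \<and>
     (\<forall>K. compact K \<and> K \<subseteq> vertical_boundary \<longrightarrow> finite {C \<in> \<C>. C \<inter> K \<noteq> {}})"

text \<open>Adjoining \<open>\<gamma>\<close> to the immersed surface \<open>F\<close>: the surface \<open>S\<close> sits, via \<open>\<iota>\<close>, in a topological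
  surface with boundary \<open>S'\<close>, and \<open>F\<close> extends to a continuous map \<open>F'\<close> into the compactification
  which sends the added points, all of them boundary points of \<open>S'\<close>, onto \<open>\<gamma>\<close>. Properness
  of \<open>F'\<close> ties the topology of \<open>S'\<close> to that of the compactification: points of \<open>S\<close> whose images
  converge to a point of \<open>\<gamma>\<close> subconverge in \<open>S'\<close>; an injective \<open>F'\<close> is a homeomorphism onto
  the subspace \<open>ext ` (F ` topspace S \<union> \<gamma>)\<close>. As \<open>F\<close> is only immersed, several sheets may meet
  along \<open>\<gamma>\<close>.\<close>

definition surface_with_ideal_boundary_curve ::
    "'a topology \<Rightarrow> ('a \<Rightarrow> complex \<times> real) \<Rightarrow> (complex \<times> real) set \<Rightarrow>
     'b topology \<Rightarrow> ('a \<Rightarrow> 'b) \<Rightarrow> ('b \<Rightarrow> complex \<times> ereal) \<Rightarrow> bool" where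
  "surface_with_ideal_boundary_curve S F \<gamma> S' \<iota> F' \<longleftrightarrow>
     topological_surface S' \<and>
     embedding_map S S' \<iota> \<and> openin S' (\<iota> ` topspace S) \<and>
     (\<forall>x\<in>topspace S. F' (\<iota> x) = ext (F x)) \<and>
     topspace S' - \<iota> ` topspace S \<subseteq> surface_boundary S' \<and>
     F' ` (topspace S' - \<iota> ` topspace S) = ext ` \<gamma> \<and>
     continuous_map S' (top_of_set (ext ` (HxR \<union> \<gamma>))) F' \<and>
     proper_map S' (top_of_set (ext ` (HxR \<union> \<gamma>))) F'"

end

theory Submission
  imports Defs
begin

text \<open>On a translator the drift Laplacian \<open>L \<phi> = \<Delta>\<^sub>M \<phi> + \<langle>\<nabla>\<^sub>M \<phi>, \<partial>\<^sub>h\<rangle>\<close> of an ambient function is the trace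
  of its Hessian over the tangent plane plus \<open>\<partial>\<^sub>h \<phi>\<close>; in particular \<open>L h = 1\<close>, and \<open>h\<close> perturbed by
  functions with small hyperbolic Hessian has no interior local maximum. Near an ideal point \<open>p\<close>
  take \<open>h - |z - p|\<^sup>2 / (32 \<delta>\<^sup>2) + s ln (1 - |z|\<^sup>2)\<close>: its Hessian on \<open>|z - p| \<le> \<delta>\<close> is bounded
  uniformly in \<open>\<delta>\<close>, and the logarithm pushes the maximum away from the ideal boundary. If \<open>(p, t)\<close>
  lies in the vertical asymptotic boundary but \<open>(p, t + \<epsilon>)\<close> with \<open>\<epsilon> < 1 / 32\<close> does not, then for
  small \<open>\<delta>\<close> the maximum over the part of \<open>M\<close> below height \<open>t + \<epsilon>\<close> would be interior. Hence the
  vertical asymptotic boundary is closed upwards in every line \<open>{p} \<times> \<real>\<close>. A component projecting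
  onto a nondegenerate arc of the circle would then force a countable union of arcs to have
  interior.\<close>


section \<open>Second derivatives\<close>

text \<open>The second difference over the parallelogram spanned by \<open>t *\<^sub>R d\<close> and
  \<open>t *\<^sub>R e\<close> is symmetric in \<open>d\<close> and \<open>e\<close>, which will
  identify the two mixed derivatives. Being the increment in direction \<open>d\<close> of a
  difference in direction \<open>e\<close>, it is evaluated by two mean value theorems. Here
  \<open>f1 e\<close> is the derivative in direction \<open>e\<close>, and \<open>f2 e d\<close>
  that of \<open>f1 e\<close> in direction \<open>d\<close>.\<close>

lemma mixed_derivatives_mean_value:
  fixes f :: "'a::real_normed_vector \<Rightarrow> real"
  assumes f1: "\<And>w. w \<in> ball u r \<Longrightarrow> (f has_derivative (\<lambda>e. f1 e w)) (at w)"
    and f2: "\<And>e w. w \<in> ball u r \<Longrightarrow> (f1 e has_derivative (\<lambda>d. f2 e d w)) (at w)"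
    and t: "0 < t" "t * (norm d + norm e) < r"
  obtains \<sigma> \<tau> where "0 < \<sigma>" "\<sigma> < t" "0 < \<tau>" "\<tau> < t"
    "f (u + t *\<^sub>R d + t *\<^sub>R e) - f (u + t *\<^sub>R d) - f (u + t *\<^sub>R e) + f u
       = t\<^sup>2 * f2 d e (u + \<sigma> *\<^sub>R d + \<tau> *\<^sub>R e)"
proof -
  have inb: "u + a *\<^sub>R d + b *\<^sub>R e \<in> ball u r" if "0 \<le> a" "a \<le> t" "0 \<le> b" "b \<le> t" for a b
  proof -
    have "norm (a *\<^sub>R d + b *\<^sub>R e) \<le> a * norm d + b * norm e"
      using norm_triangle_ineq[of "a *\<^sub>R d" "b *\<^sub>R e"] that by simp
    also have "\<dots> \<le> t * norm d + t * norm e"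
      using that by (intro add_mono mult_right_mono) auto
    finally have "norm (a *\<^sub>R d + b *\<^sub>R e) < r" using t by (simp add: algebra_simps)
    then show ?thesis
      by (metis add.assoc add_diff_cancel_left' dist_commute dist_norm mem_ball)
  qed
  have lin: "((\<lambda>s. p + s *\<^sub>R v) has_derivative (\<lambda>h. h *\<^sub>R v)) (at s)" for p v :: 'a and s :: real
    by (auto intro!: derivative_eq_intros)
  have D1: "((\<lambda>s. f (p + s *\<^sub>R v)) has_real_derivative f1 v (p + s *\<^sub>R v)) (at s)"
    if "p + s *\<^sub>R v \<in> ball u r" for p v s
  proof -
    interpret linear "\<lambda>e. f1 e (p + s *\<^sub>R v)"
      using f1[OF that] has_derivative_linear by blast
    show ?thesis
      using has_derivative_compose[OF lin f1[OF that]]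
      by (simp add: scaleR mult_commute_abs has_field_derivative_def)
  qed
  have D2: "((\<lambda>s. f1 d (p + s *\<^sub>R v)) has_real_derivative f2 d v (p + s *\<^sub>R v)) (at s)"
    if "p + s *\<^sub>R v \<in> ball u r" for p v s
  proof -
    interpret linear "\<lambda>e. f2 d e (p + s *\<^sub>R v)"
      using f2[OF that] has_derivative_linear by blast
    show ?thesis
      using has_derivative_compose[OF lin f2[OF that, of d]]
      by (simp add: scaleR mult_commute_abs has_field_derivative_def)
  qed
  define g where "g = (\<lambda>s. f (u + t *\<^sub>R e + s *\<^sub>R d) - f (u + s *\<^sub>R d))"
  have "(g has_real_derivative f1 d (u + t *\<^sub>R e + s *\<^sub>R d) - f1 d (u + s *\<^sub>R d)) (at s)"
    if "0 \<le> s" "s \<le> t" for s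
    unfolding g_def
    using inb[of s t] inb[of s 0] that t
    by (intro DERIV_diff D1) (auto simp: algebra_simps)
  from MVT2[OF t(1) this] obtain \<sigma> where \<sigma>: "0 < \<sigma>" "\<sigma> < t"
    "g t - g 0 = t * (f1 d (u + t *\<^sub>R e + \<sigma> *\<^sub>R d) - f1 d (u + \<sigma> *\<^sub>R d))"
    by auto
  have "((\<lambda>s. f1 d (u + \<sigma> *\<^sub>R d + s *\<^sub>R e)) has_real_derivative
       f2 d e (u + \<sigma> *\<^sub>R d + s *\<^sub>R e)) (at s)"
    if "0 \<le> s" "s \<le> t" for s
    using inb[of \<sigma> s] that \<sigma> by (intro D2) auto
  from MVT2[OF t(1) this] obtain \<tau> where \<tau>: "0 < \<tau>" "\<tau> < t"
    "f1 d (u + \<sigma> *\<^sub>R d + t *\<^sub>R e) - f1 d (u + \<sigma> *\<^sub>R d) = t * f2 d e (u + \<sigma> *\<^sub>R d + \<tau> *\<^sub>R e)"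
    by auto
  show thesis
    by (rule that[OF \<sigma>(1,2) \<tau>(1,2)])
      (use \<sigma>(3) \<tau>(3) in \<open>simp add: g_def power2_eq_square algebra_simps\<close>)
qed

text \<open>Swapping the directions in the second difference gives values of \<open>f2 d e\<close>
  and \<open>f2 e d\<close> that agree at two points near \<open>u\<close>; continuity carries this
  to \<open>u\<close>.\<close>

lemma mixed_derivatives_commute_real:
  fixes f :: "'a::real_normed_vector \<Rightarrow> real"
  assumes "open W" "u \<in> W"
    and f1: "\<And>w. w \<in> W \<Longrightarrow> (f has_derivative (\<lambda>e. f1 e w)) (at w)"
    and f2: "\<And>e w. w \<in> W \<Longrightarrow> (f1 e has_derivative (\<lambda>d. f2 e d w)) (at w)"
    and cont: "\<And>e d. continuous_on W (f2 e d)"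
  shows "f2 d e u = f2 e d u"
proof (rule ccontr)
  assume ne: "f2 d e u \<noteq> f2 e d u"
  \<comment> \<open>Half the gap: values closer than \<eta> to the two sides cannot
    coincide.\<close>
  define \<eta> where "\<eta> = \<bar>f2 d e u - f2 e d u\<bar> / 2"
  have \<eta>: "\<eta> > 0" using ne by (simp add: \<eta>_def)
  have "\<forall>\<^sub>F w in at u. dist (f2 d e w) (f2 d e u) < \<eta> \<and> dist (f2 e d w) (f2 e d u) < \<eta> \<and> w \<in> W"
    using assms(1,2) cont \<eta>
    by (intro eventually_conj tendstoD) (auto simp: continuous_on_eq_continuous_at isCont_def
        eventually_at_topological)
  then obtain r where r: "r > 0"
    "\<And>w. w \<noteq> u \<Longrightarrow> dist w u < r \<Longrightarrow>
      dist (f2 d e w) (f2 d e u) < \<eta> \<and> dist (f2 e d w) (f2 e d u) < \<eta> \<and> w \<in> W"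
    by (auto simp: eventually_at)
  have near: "dist (f2 d e w) (f2 d e u) < \<eta> \<and> dist (f2 e d w) (f2 e d u) < \<eta> \<and> w \<in> W"
    if "w \<in> ball u r" for w
    using r(2)[of w] that assms(2) \<eta> by (cases "w = u") (auto simp: dist_commute)
  \<comment> \<open>The summand \<open>1\<close> keeps \<open>N\<close> positive when both
    directions vanish.\<close>
  define N where "N = norm d + norm e + 1"
  define t where "t = r / (2 * N)"
  have pos: "0 < N" by (simp add: N_def add_nonneg_pos)
  have t: "t > 0" "t * (norm d + norm e) < r"
  proof -
    show "t > 0" using r(1) pos by (simp add: t_def)
    then have "t * (norm d + norm e) \<le> t * N" by (simp add: N_def)
    also have "\<dots> = r / 2" using pos by (simp add: t_def)
    finally show "t * (norm d + norm e) < r" using r(1) by simp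
  qed
  have inb: "u + \<sigma> *\<^sub>R a + \<tau> *\<^sub>R b \<in> ball u r"
    if "0 < \<sigma>" "\<sigma> < t" "0 < \<tau>" "\<tau> < t" "{a, b} = {d, e}" for \<sigma> \<tau> a b
  proof -
    have "norm (\<sigma> *\<^sub>R a + \<tau> *\<^sub>R b) \<le> \<sigma> * norm a + \<tau> * norm b"
      using norm_triangle_ineq[of "\<sigma> *\<^sub>R a" "\<tau> *\<^sub>R b"] that by simp
    also have "\<dots> \<le> t * norm a + t * norm b"
      using that by (intro add_mono mult_right_mono) auto
    also have "\<dots> = t * (norm d + norm e)"
      using that by (auto simp: doubleton_eq_iff algebra_simps)
    finally have "norm (\<sigma> *\<^sub>R a + \<tau> *\<^sub>R b) < r" using t by simp
    then show ?thesis by (metis add.assoc add_diff_cancel_left' dist_commute dist_norm mem_ball)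
  qed
  note f1' = f1[OF near[THEN conjunct2, THEN conjunct2]]
  note f2' = f2[OF near[THEN conjunct2, THEN conjunct2]]
  obtain \<sigma> \<tau> where 1: "0 < \<sigma>" "\<sigma> < t" "0 < \<tau>" "\<tau> < t"
    "f (u + t *\<^sub>R d + t *\<^sub>R e) - f (u + t *\<^sub>R d) - f (u + t *\<^sub>R e) + f u
       = t\<^sup>2 * f2 d e (u + \<sigma> *\<^sub>R d + \<tau> *\<^sub>R e)"
    using mixed_derivatives_mean_value[where f=f and ?f1.0=f1 and ?f2.0=f2, OF f1' f2' t] by blast
  have t': "t * (norm e + norm d) < r" using t by (simp add: add.commute)
  obtain \<sigma>' \<tau>' where 2: "0 < \<sigma>'" "\<sigma>' < t" "0 < \<tau>'" "\<tau>' < t"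
    "f (u + t *\<^sub>R e + t *\<^sub>R d) - f (u + t *\<^sub>R e) - f (u + t *\<^sub>R d) + f u
       = t\<^sup>2 * f2 e d (u + \<sigma>' *\<^sub>R e + \<tau>' *\<^sub>R d)"
    using mixed_derivatives_mean_value[where f=f and ?f1.0=f1 and ?f2.0=f2, OF f1' f2' t(1) t'] by blast
  have sw: "u + t *\<^sub>R e + t *\<^sub>R d = u + t *\<^sub>R d + t *\<^sub>R e" by simp
  have "t\<^sup>2 * f2 d e (u + \<sigma> *\<^sub>R d + \<tau> *\<^sub>R e) = t\<^sup>2 * f2 e d (u + \<sigma>' *\<^sub>R e + \<tau>' *\<^sub>R d)"
    using 1(5) 2(5) unfolding sw by linarith
  then have eq: "f2 d e (u + \<sigma> *\<^sub>R d + \<tau> *\<^sub>R e) = f2 e d (u + \<sigma>' *\<^sub>R e + \<tau>' *\<^sub>R d)"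
    using t(1) by simp
  have "dist (f2 d e (u + \<sigma> *\<^sub>R d + \<tau> *\<^sub>R e)) (f2 d e u) < \<eta>"
    "dist (f2 e d (u + \<sigma>' *\<^sub>R e + \<tau>' *\<^sub>R d)) (f2 e d u) < \<eta>"
    using near[OF inb] 1 2 by auto
  then show False
    unfolding eq \<eta>_def dist_real_def by (smt (verit) field_sum_of_halves)
qed

lemma mixed_derivatives_commute:
  fixes f :: "'a::real_normed_vector \<Rightarrow> 'b::euclidean_space"
  assumes "open W" "u \<in> W"
    and f1: "\<And>w. w \<in> W \<Longrightarrow> (f has_derivative (\<lambda>e. f1 e w)) (at w)"
    and f2: "\<And>e w. w \<in> W \<Longrightarrow> (f1 e has_derivative (\<lambda>d. f2 e d w)) (at w)"
    and cont: "\<And>e d. continuous_on W (f2 e d)"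
  shows "f2 d e u = f2 e d u"
proof (rule euclidean_eqI)
  fix b :: 'b assume "b \<in> Basis"
  show "f2 d e u \<bullet> b = f2 e d u \<bullet> b"
    by (rule mixed_derivatives_commute_real[where f="\<lambda>w. f w \<bullet> b" and ?f1.0="\<lambda>e w. f1 e w \<bullet> b"
          and ?f2.0="\<lambda>e d w. f2 e d w \<bullet> b", OF assms(1,2)])
      (auto intro!: has_derivative_inner_left f1 f2 continuous_on_inner cont continuous_on_const)
qed

text \<open>If \<open>m\<close> were positive, \<open>\<psi>'\<close> would be positive just to the
  right of \<open>0\<close>, and the mean value theorem would push \<open>\<psi>\<close> above its
  maximum.\<close>

lemma second_derivative_nonpos_at_local_max:
  fixes \<psi> :: "real \<Rightarrow> real"
  assumes "0 < r"
    and d1: "\<And>t. \<bar>t\<bar> < r \<Longrightarrow> (\<psi> has_real_derivative \<psi>' t) (at t)"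
    and d2: "(\<psi>' has_real_derivative m) (at 0)"
    and max: "\<And>t. \<bar>t\<bar> < r \<Longrightarrow> \<psi> t \<le> \<psi> 0"
  shows "\<psi>' 0 = 0" "m \<le> 0"
proof -
  show 0: "\<psi>' 0 = 0"
    using DERIV_local_max[OF d1[of 0] \<open>0 < r\<close>] max \<open>0 < r\<close> by auto
  show "m \<le> 0"
  proof (rule ccontr)
    assume "\<not> m \<le> 0"
    then obtain d where d: "d > 0" "\<And>h. 0 < h \<Longrightarrow> h < d \<Longrightarrow> \<psi>' 0 < \<psi>' h"
      using DERIV_pos_inc_right[OF d2] by auto
    define t where "t = min (d / 2) (r / 2)"
    have t: "0 < t" "t < d" "t < r" using d \<open>0 < r\<close> by (auto simp: t_def min_def)
    obtain z where z: "0 < z" "z < t" "\<psi> t - \<psi> 0 = (t - 0) * \<psi>' z"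
      using MVT2[OF t(1), of \<psi> \<psi>'] d1 t by fastforce
    have "\<psi>' z > 0" using d(2)[of z] z t 0 by auto
    then have "\<psi> t > \<psi> 0" using z t by (metis diff_gt_0_iff_gt diff_zero mult_pos_pos)
    then show False using max[of t] t by auto
  qed
qed

text \<open>The expression is the trace of \<open>m\<close> against the adjugate of
  \<open>g\<close>, hence the determinant of \<open>g\<close> times the metric trace of
  \<open>m\<close> when \<open>g\<close> is nondegenerate. For \<open>g11 > 0\<close> it suffices to
  test both forms on \<open>(g12, - g11)\<close>.\<close>

lemma psd_trace_nonneg:
  fixes g11 g12 g22 m11 m12 m22 :: real
  assumes g: "\<And>a b. 0 \<le> a\<^sup>2 * g11 + 2 * a * b * g12 + b\<^sup>2 * g22"
    and m: "\<And>a b. 0 \<le> a\<^sup>2 * m11 + 2 * a * b * m12 + b\<^sup>2 * m22"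
  shows "0 \<le> g22 * m11 - 2 * g12 * m12 + g11 * m22"
proof -
  have g11: "0 \<le> g11" and g22: "0 \<le> g22" using g[of 1 0] g[of 0 1] by auto
  have m11: "0 \<le> m11" and m22: "0 \<le> m22" using m[of 1 0] m[of 0 1] by auto
  show ?thesis
  proof (cases "g11 = 0")
    case True
    have "g12 = 0"
    proof (rule ccontr)
      assume "g12 \<noteq> 0"
      \<comment> \<open>With \<open>g11 = 0\<close> the form is affine along the vectors
        \<open>(a, 1)\<close>; this \<open>a\<close> gives it the value \<open>-1\<close>.\<close>
      then have "2 * (- (g22 + 1) / (2 * g12)) * g12 = - (g22 + 1)" by simp
      then show False using g[of "- (g22 + 1) / (2 * g12)" 1] True by simp
    qed
    then show ?thesis using True g22 m11 by simp
  next
    case False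
    then have pos: "g11 > 0" using g11 by simp
    have det: "g12\<^sup>2 \<le> g11 * g22"
    proof -
      have "0 \<le> g11 * (g11 * g22 - g12\<^sup>2)"
        using g[of g12 "- g11"] by (simp add: power2_eq_square algebra_simps)
      then show ?thesis using pos by (simp add: zero_le_mult_iff)
    qed
    have "0 \<le> g12\<^sup>2 * m11 - 2 * g12 * g11 * m12 + g11\<^sup>2 * m22"
      using m[of g12 "- g11"] by (simp add: algebra_simps)
    also have "\<dots> \<le> g11 * g22 * m11 - 2 * g12 * g11 * m12 + g11\<^sup>2 * m22"
      using mult_right_mono[OF det m11] by simp
    also have "\<dots> = g11 * (g22 * m11 - 2 * g12 * m12 + g11 * m22)"
      by (simp add: power2_eq_square algebra_simps)
    finally show ?thesis using pos by (simp add: zero_le_mult_iff)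
  qed
qed


section \<open>A maximum principle for translators\<close>

lemma HxR_one_minus_norm_pos:
  assumes "p \<in> HxR"
  shows "0 < 1 - (norm (fst p))\<^sup>2"
  using assms abs_square_less_1[of "norm (fst p)"] by (auto simp: HxR_def)

lemma HxR_metric_pos:
  assumes "p \<in> HxR" "v \<noteq> 0"
  shows "0 < HxR_metric p v v"
proof -
  have c: "0 < (2 / (1 - (norm (fst p))\<^sup>2))\<^sup>2"
    using HxR_one_minus_norm_pos[OF assms(1)] by (intro zero_less_power divide_pos_pos) auto
  show ?thesis
  proof (cases "snd v = 0")
    case True
    then have "0 < fst v \<bullet> fst v" using assms by (auto simp: prod_eq_iff)
    then show ?thesis using True c by (simp add: HxR_metric_def)
  next
    case False
    then have "0 < snd v * snd v" using not_real_square_gt_zero by blast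
    moreover have "0 \<le> (2 / (1 - (norm (fst p))\<^sup>2))\<^sup>2 * (fst v \<bullet> fst v)"
      using c by simp
    ultimately show ?thesis unfolding HxR_metric_def by (rule add_nonneg_pos[rotated])
  qed
qed

lemma HxR_metric_add_left: "HxR_metric p (v + v') w = HxR_metric p v w + HxR_metric p v' w"
  by (simp add: HxR_metric_def inner_add_left algebra_simps)

lemma HxR_metric_scaleR_left: "HxR_metric p (c *\<^sub>R v) w = c * HxR_metric p v w"
  by (simp add: HxR_metric_def algebra_simps)

lemma HxR_metric_sym: "HxR_metric p v w = HxR_metric p w v"
  by (simp add: HxR_metric_def inner_commute algebra_simps)

lemma HxR_christoffel_add_left:
  "HxR_christoffel p (v + v') w = HxR_christoffel p v w + HxR_christoffel p v' w"
  by (simp add: HxR_christoffel_def Let_def inner_add_left inner_add_right add_divide_distrib algebra_simps)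

lemma HxR_christoffel_scaleR_left:
  "HxR_christoffel p (c *\<^sub>R v) w = c *\<^sub>R HxR_christoffel p v w"
  by (simp add: HxR_christoffel_def Let_def algebra_simps)

text \<open>Index raising: \<nu> stands for the Euclidean gradient of a function, and the inverse
  metric turns it into the Riemannian gradient.\<close>

definition HxR_gradient :: "complex \<times> real \<Rightarrow> complex \<times> real \<Rightarrow> complex \<times> real" where
  "HxR_gradient p \<nu> = (((1 - (norm (fst p))\<^sup>2) / 2)\<^sup>2 *\<^sub>R fst \<nu>, snd \<nu>)"

lemma HxR_metric_gradient:
  assumes "p \<in> HxR"
  shows "HxR_metric p v (HxR_gradient p \<nu>) = \<nu> \<bullet> v"
proof -
  have "1 - (norm (fst p))\<^sup>2 \<noteq> 0"
    using HxR_one_minus_norm_pos[OF assms] by simp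
  then show ?thesis
    by (simp add: HxR_metric_def HxR_gradient_def inner_prod_def inner_commute power2_eq_square)
qed

lemma bilinear_quadratic_expansion:
  fixes f :: "real \<times> real \<Rightarrow> real \<times> real \<Rightarrow> 'a::real_vector"
  assumes "\<And>v. linear (\<lambda>u. f u v)" "\<And>u. linear (f u)"
  shows "f (a, b) (a, b) = a\<^sup>2 *\<^sub>R f (1,0) (1,0) + (a * b) *\<^sub>R (f (1,0) (0,1) + f (0,1) (1,0))
    + b\<^sup>2 *\<^sub>R f (0,1) (0,1)"
proof -
  have ab: "(a, b) = a *\<^sub>R (1, 0) + b *\<^sub>R (0, 1 :: real)" for a b :: real by simp
  show ?thesis
    unfolding ab[of a b]
    by (simp add: linear_add[OF assms(1)] linear_add[OF assms(2)] linear_cmul[OF assms(1)]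
        linear_cmul[OF assms(2)] power2_eq_square algebra_simps del: scaleR_Pair add_Pair)
qed

text \<open>At a local maximum the Riemannian gradient of \<open>\<Phi>\<close> is normal to the surface, so the mean
  curvature equation evaluates the gradient term of the trace of the Hessian of \<open>\<Phi> \<circ> X\<close> as
  \<open>\<partial>\<^sub>h \<Phi>\<close>; the remaining part of the trace is at least \<open>-2 k\<close>.\<close>

lemma immersed_translator_no_local_max:
  fixes X :: "real \<times> real \<Rightarrow> complex \<times> real" and \<Phi> :: "complex \<times> real \<Rightarrow> real"
  assumes W: "open W" "u \<in> W" "W \<subseteq> D"
    and C2: "Ck_on 2 X D"
    and imm: "inj (frechet_derivative X (at u within D))"
    and XH: "X u \<in> HxR"
    and tr: "\<And>N. is_unit_normal D X u N \<Longrightarrow> mean_curvature D X u N = HxR_metric (X u) N (0, 1)"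
    and G: "X ` W \<subseteq> G"
    and \<Phi>1: "\<And>q. q \<in> G \<Longrightarrow> (\<Phi> has_derivative (\<lambda>v. \<nu> q \<bullet> v)) (at q)"
    and \<Phi>2: "(\<nu> has_derivative \<nu>') (at (X u))"
    and hess: "\<And>v. \<nu>' v \<bullet> v - \<nu> (X u) \<bullet> HxR_christoffel (X u) v v \<ge> - k * HxR_metric (X u) v v"
    and k: "0 \<le> k" "2 * k < snd (\<nu> (X u))"
    and max: "\<And>w. w \<in> W \<Longrightarrow> \<Phi> (X w) \<le> \<Phi> (X u)"
  shows False
proof -
  define Xd where "Xd = (\<lambda>e. partial D e X)"
  define Xdd where "Xdd = (\<lambda>e d. partial D d (partial D e X))"
  \<comment> \<open>On the open set \<open>W\<close> the derivatives within \<open>D\<close> are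
    ordinary two-sided ones.\<close>
  have at: "at w within D = at w" if "w \<in> W" for w
    using at_within_open_subset[OF that W(1,3)] .
  have partial_eq: "partial D e f = (\<lambda>w. frechet_derivative f (at w within D) e)" for e f
    by (auto simp: partial_def)
  have "X differentiable_on D" "Xd e differentiable_on D" "continuous_on D (Xdd e d)" for e d
    using C2 by (simp_all add: numeral_2_eq_2 Xd_def Xdd_def partial_eq del: split_paired_All)
  note diff = this
  have X1: "(X has_derivative (\<lambda>e. Xd e w)) (at w)" if "w \<in> W" for w
    using diff(1) that W(3)
    by (auto simp: Xd_def partial_eq differentiable_on_def
        frechet_derivative_works[symmetric] simp flip: at)
  have X2: "(Xd e has_derivative (\<lambda>d. Xdd e d w)) (at w)" if "w \<in> W" for w e
    using diff(2)[of e] that W(3) unfolding Xdd_def Xd_def[symmetric]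
    by (auto simp: Xd_def partial_def differentiable_on_def
        frechet_derivative_works[symmetric] simp flip: at)
  have X3: "continuous_on W (Xdd e d)" for e d
    using diff(3) continuous_on_subset[OF _ W(3)] by blast
  have comm: "Xdd d e u = Xdd e d u" for d e
    using mixed_derivatives_commute[OF W(1,2) X1 X2 X3] .
  define p where "p = X u"
  define \<mu> where "\<mu> = \<nu> p"
  have lin1: "linear (\<lambda>e. Xd e u)" using X1[OF W(2)] has_derivative_linear by blast
  have lin2: "linear (\<lambda>d. Xdd e d u)" for e using X2[OF W(2)] has_derivative_linear by blast
  \<comment> \<open>First and second derivative tests for \<Phi> along the images under
    \<open>X\<close> of the lines \<open>u + t *\<^sub>R e\<close>.\<close>
  have crit: "\<mu> \<bullet> Xd e u = 0" and second: "\<nu>' (Xd e u) \<bullet> Xd e u + \<mu> \<bullet> Xdd e e u \<le> 0" for e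
  proof -
    obtain r where r: "r > 0" "ball u r \<subseteq> W" using W open_contains_ball by blast
    define r' where "r' = r / (norm e + 1)"
    have r': "r' > 0" using r by (simp add: r'_def add_nonneg_pos)
    have inW: "u + t *\<^sub>R e \<in> W" if "\<bar>t\<bar> < r'" for t
    proof -
      have "norm (t *\<^sub>R e) \<le> \<bar>t\<bar> * (norm e + 1)" by (simp add: mult_left_mono)
      also have "\<dots> < r" using that by (simp add: r'_def pos_less_divide_eq add_nonneg_pos)
      finally show ?thesis using r(2) by (auto simp: dist_norm)
    qed
    have line: "((\<lambda>t. u + t *\<^sub>R e) has_derivative (\<lambda>h. h *\<^sub>R e)) (at t)" for t
      by (auto intro!: derivative_eq_intros)
    have dX: "((\<lambda>t. X (u + t *\<^sub>R e)) has_derivative (\<lambda>h. h *\<^sub>R Xd e (u + t *\<^sub>R e))) (at t)"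
      if "\<bar>t\<bar> < r'" for t
    proof -
      have "linear (\<lambda>e'. Xd e' (u + t *\<^sub>R e))" using X1[OF inW[OF that]] has_derivative_linear by blast
      then show ?thesis
        using has_derivative_compose[OF line X1[OF inW[OF that]]] by (simp add: linear_cmul[of "\<lambda>e'. Xd e' (u + t *\<^sub>R e)"])
    qed
    have dXd: "((\<lambda>t. Xd e (u + t *\<^sub>R e)) has_derivative (\<lambda>h. h *\<^sub>R Xdd e e (u + t *\<^sub>R e))) (at t)"
      if "\<bar>t\<bar> < r'" for t
    proof -
      have "linear (\<lambda>e'. Xdd e e' (u + t *\<^sub>R e))" using X2[OF inW[OF that]] has_derivative_linear by blast
      then show ?thesis
        using has_derivative_compose[OF line X2[OF inW[OF that], of e]] by (simp add: linear_cmul[of "\<lambda>e'. Xdd e e' (u + t *\<^sub>R e)"])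
    qed
    have d1: "((\<lambda>t. \<Phi> (X (u + t *\<^sub>R e))) has_real_derivative
        \<nu> (X (u + t *\<^sub>R e)) \<bullet> Xd e (u + t *\<^sub>R e)) (at t)" if "\<bar>t\<bar> < r'" for t
    proof -
      have "X (u + t *\<^sub>R e) \<in> G" using G inW[OF that] by blast
      from has_derivative_compose[OF dX[OF that] \<Phi>1[OF this]]
      show ?thesis by (simp add: has_field_derivative_def mult_commute_abs)
    qed
    have lin\<nu>: "linear \<nu>'" using \<Phi>2 has_derivative_linear by blast
    have "((\<lambda>t. \<nu> (X (u + t *\<^sub>R e))) has_derivative (\<lambda>h. h *\<^sub>R \<nu>' (Xd e u))) (at 0)"
      using has_derivative_compose[OF dX[of 0], of \<nu> \<nu>'] \<Phi>2 r' by (simp add: linear_cmul[OF lin\<nu>])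
    from has_derivative_inner[OF this dXd[of 0]] r'
    have d2: "((\<lambda>t. \<nu> (X (u + t *\<^sub>R e)) \<bullet> Xd e (u + t *\<^sub>R e)) has_real_derivative
        \<nu>' (Xd e u) \<bullet> Xd e u + \<mu> \<bullet> Xdd e e u) (at 0)"
      by (simp add: has_field_derivative_def \<mu>_def p_def)
        (erule has_derivative_eq_rhs, auto simp: algebra_simps)
    note test = second_derivative_nonpos_at_local_max[OF r' d1 d2]
    show "\<mu> \<bullet> Xd e u = 0"
      using test(1) max[OF inW] by (simp add: \<mu>_def p_def)
    show "\<nu>' (Xd e u) \<bullet> Xd e u + \<mu> \<bullet> Xdd e e u \<le> 0"
      using test(2) max[OF inW] by simp
  qed
  \<comment> \<open>The covariant derivative of \<open>Xd e\<close> along \<open>Xd d\<close>; its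
    component along a unit normal is the second fundamental form.\<close>
  define K where "K = (\<lambda>d e. Xdd e d u + HxR_christoffel p (Xd d u) (Xd e u))"
  define g where "g = (\<lambda>d e. HxR_metric p (Xd d u) (Xd e u))"
  have g_eq: "first_fundamental_form D X u = g"
    by (auto simp: fun_eq_iff first_fundamental_form_def g_def p_def Xd_def)
  \<comment> \<open>The Christoffel terms of \<open>hess\<close> and of \<open>K\<close> cancel, so
    the second derivative test becomes a bound by the metric.\<close>
  have le: "\<mu> \<bullet> K e e \<le> k * g e e" for e
    using hess[of "Xd e u"] second[of e]
    by (simp add: K_def g_def inner_add_right \<mu>_def p_def)
  have K_sym: "K d e = K e d" for d e
    by (simp add: K_def comm[of d e] HxR_christoffel_sym[of p "Xd d u"])
  have linK1: "linear (\<lambda>d. K d e)" for e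
    by (rule linearI) (simp_all only: K_def linear_add[OF lin1] linear_cmul[OF lin1]
        linear_add[OF lin2] linear_cmul[OF lin2] HxR_christoffel_add_left
        HxR_christoffel_scaleR_left scaleR_right_distrib add_ac)
  have linK2: "linear (K d)" for d
    using linK1[of d] K_sym[of d] by (metis (no_types, lifting) ext)
  have g_sym: "g d e = g e d" for d e by (simp add: g_def HxR_metric_sym)
  have ling1: "linear (\<lambda>d. g d e)" for e
    by (rule linearI) (simp_all only: g_def linear_add[OF lin1] linear_cmul[OF lin1]
        HxR_metric_add_left HxR_metric_scaleR_left real_scaleR_def)
  have ling2: "linear (g d)" for d
    using ling1[of d] g_sym[of d] by (metis (no_types, lifting) ext)
  define e\<^sub>1 e\<^sub>2 :: "real \<times> real" where "e\<^sub>1 = (1, 0)" and "e\<^sub>2 = (0, 1)"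
  have g_exp: "g (a, b) (a, b) = a\<^sup>2 * g e\<^sub>1 e\<^sub>1 + 2 * a * b * g e\<^sub>1 e\<^sub>2 + b\<^sup>2 * g e\<^sub>2 e\<^sub>2" for a b
    using bilinear_quadratic_expansion[OF ling1 ling2, of a b]
    by (simp add: e\<^sub>1_def e\<^sub>2_def g_sym[of "(0, 1)" "(1, 0)"])
  have K_exp: "\<mu> \<bullet> K (a, b) (a, b) =
      a\<^sup>2 * (\<mu> \<bullet> K e\<^sub>1 e\<^sub>1) + 2 * a * b * (\<mu> \<bullet> K e\<^sub>1 e\<^sub>2) + b\<^sup>2 * (\<mu> \<bullet> K e\<^sub>2 e\<^sub>2)" for a b
    using bilinear_quadratic_expansion[OF linK1 linK2, of a b]
    by (simp add: e\<^sub>1_def e\<^sub>2_def K_sym[of "(0, 1)" "(1, 0)"] inner_add_right)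
  have g_pos: "0 < g e e" if "e \<noteq> 0" for e
  proof -
    have "inj (\<lambda>e. Xd e u)" using imm by (simp add: Xd_def partial_def inj_def)
    then have "Xd e u \<noteq> 0" using that linear_0[OF lin1] by (metis injD)
    then show ?thesis using HxR_metric_pos XH by (simp add: g_def p_def)
  qed
  have g_nonneg: "0 \<le> g e e" for e
    using g_pos[of e] linear_0[OF ling2] by (cases "e = 0") auto
  define det where "det = g e\<^sub>1 e\<^sub>1 * g e\<^sub>2 e\<^sub>2 - (g e\<^sub>1 e\<^sub>2)\<^sup>2"
  have det: "0 < det"
  proof -
    have g11: "0 < g e\<^sub>1 e\<^sub>1" using g_pos[of e\<^sub>1] by (simp add: e\<^sub>1_def zero_prod_def)
    then have "0 < g (g e\<^sub>1 e\<^sub>2, - g e\<^sub>1 e\<^sub>1) (g e\<^sub>1 e\<^sub>2, - g e\<^sub>1 e\<^sub>1)"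
      by (intro g_pos) (simp add: zero_prod_def)
    also have "\<dots> = g e\<^sub>1 e\<^sub>1 * det"
      by (simp add: g_exp det_def power2_eq_square algebra_simps)
    finally show ?thesis using g11 by (simp add: zero_less_mult_iff)
  qed
  \<comment> \<open>The numerator of \<open>mean_curvature\<close>, with the pairing with \<mu> in
    place of the unit normal.\<close>
  define T where "T = g e\<^sub>2 e\<^sub>2 * (\<mu> \<bullet> K e\<^sub>1 e\<^sub>1) - 2 * g e\<^sub>1 e\<^sub>2 * (\<mu> \<bullet> K e\<^sub>1 e\<^sub>2) + g e\<^sub>1 e\<^sub>1 * (\<mu> \<bullet> K e\<^sub>2 e\<^sub>2)"
  \<comment> \<open>The forms \<open>g\<close> and \<open>k * g - \<mu> \<bullet> K\<close> are both
    positive semidefinite; the trace expression of \<open>g\<close> against itself is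
    \<open>2 * det\<close>.\<close>
  have "0 \<le> g e\<^sub>2 e\<^sub>2 * (k * g e\<^sub>1 e\<^sub>1 - \<mu> \<bullet> K e\<^sub>1 e\<^sub>1) - 2 * g e\<^sub>1 e\<^sub>2 * (k * g e\<^sub>1 e\<^sub>2 - \<mu> \<bullet> K e\<^sub>1 e\<^sub>2)
      + g e\<^sub>1 e\<^sub>1 * (k * g e\<^sub>2 e\<^sub>2 - \<mu> \<bullet> K e\<^sub>2 e\<^sub>2)"
  proof (rule psd_trace_nonneg)
    fix a b
    show "0 \<le> a\<^sup>2 * g e\<^sub>1 e\<^sub>1 + 2 * a * b * g e\<^sub>1 e\<^sub>2 + b\<^sup>2 * g e\<^sub>2 e\<^sub>2"
      using g_nonneg[of "(a, b)"] g_exp by simp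
    show "0 \<le> a\<^sup>2 * (k * g e\<^sub>1 e\<^sub>1 - \<mu> \<bullet> K e\<^sub>1 e\<^sub>1) + 2 * a * b * (k * g e\<^sub>1 e\<^sub>2 - \<mu> \<bullet> K e\<^sub>1 e\<^sub>2)
        + b\<^sup>2 * (k * g e\<^sub>2 e\<^sub>2 - \<mu> \<bullet> K e\<^sub>2 e\<^sub>2)"
      using le[of "(a, b)"] unfolding g_exp K_exp by (simp add: algebra_simps)
  qed
  then have T_le: "T \<le> 2 * k * det"
    by (simp add: T_def det_def power2_eq_square algebra_simps)
  \<comment> \<open>By \<open>crit\<close> the Riemannian gradient of \<Phi> is orthogonal to the
    surface. Its vertical component is positive, so it can be normalized to a unit normal.\<close>
  define n where "n = HxR_gradient p \<mu>"
  have p: "p \<in> HxR" using XH by (simp add: p_def)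
  have n_inner: "HxR_metric p v n = \<mu> \<bullet> v" for v
    using HxR_metric_gradient[OF p] by (simp add: n_def)
  have sn: "snd \<mu> > 0" using k by (simp add: \<mu>_def p_def)
  then have "n \<noteq> 0" by (auto simp: n_def HxR_gradient_def zero_prod_def)
  then have nn: "0 < HxR_metric p n n" using HxR_metric_pos p by blast
  define c where "c = 1 / sqrt (HxR_metric p n n)"
  have c: "0 < c" "c\<^sup>2 * HxR_metric p n n = 1" using nn by (auto simp: c_def power_divide)
  have N_inner: "HxR_metric p v (c *\<^sub>R n) = c * (\<mu> \<bullet> v)" for v
    using n_inner[of v] by (metis HxR_metric_scaleR_left HxR_metric_sym)
  have "is_unit_normal D X u (c *\<^sub>R n)"
    unfolding is_unit_normal_def
  proof (intro conjI allI)
    show "HxR_metric (X u) (c *\<^sub>R n) (c *\<^sub>R n) = 1"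
      using c(2) HxR_metric_scaleR_left[of p c n n] HxR_metric_scaleR_left[of p c n "c *\<^sub>R n"]
      by (simp add: HxR_metric_sym[of p n "c *\<^sub>R n"] power2_eq_square mult.assoc flip: p_def)
    show "HxR_metric (X u) (partial D e X u) (c *\<^sub>R n) = 0" for e
      using crit[of e] N_inner[of "Xd e u"] by (simp add: Xd_def p_def)
  qed
  then have "mean_curvature D X u (c *\<^sub>R n) = HxR_metric p (c *\<^sub>R n) (0, 1)"
    using tr by (simp add: p_def)
  moreover have "HxR_metric p (c *\<^sub>R n) (0, 1) = c * snd \<mu>"
    using N_inner[of "(0, 1)"] by (simp add: HxR_metric_sym inner_prod_def)
  moreover have "second_fundamental_form D X u (c *\<^sub>R n) d e = c * (\<mu> \<bullet> K d e)" for d e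
    using N_inner[of "K d e"]
    by (simp add: second_fundamental_form_def K_def Xd_def Xdd_def p_def)
  \<comment> \<open>The translator equation for this normal makes \<open>T / det\<close> the
    vertical derivative of \<Phi>, which exceeds \<open>2 * k\<close>, against
    \<open>T_le\<close>.\<close>
  ultimately have "c * T / det = c * snd \<mu>"
    by (simp add: mean_curvature_def Let_def g_eq T_def det_def algebra_simps
        flip: e\<^sub>1_def e\<^sub>2_def)
  then have "T = snd \<mu> * det" using c det by (simp add: field_simps)
  then show False using T_le k det by (simp add: \<mu>_def p_def)
qed

section \<open>From charts to the surface\<close>

lemma surface_chart_facts:
  assumes "surface_chart S U \<phi>"
  shows "openin S U" "U \<subseteq> topspace S" "inj_on \<phi> U" "continuous_map (subtopology S U) euclidean \<phi>"
    and "\<exists>T. open T \<and> \<phi> ` U = T \<inter> half_plane"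
proof -
  show U: "openin S U" using assms by (simp add: surface_chart_def)
  then show sub: "U \<subseteq> topspace S" by (rule openin_subset)
  have hom: "homeomorphic_map (subtopology S U) (top_of_set (\<phi> ` U)) \<phi>"
    using assms by (simp add: surface_chart_def)
  show "inj_on \<phi> U"
    using homeomorphic_imp_injective_map[OF hom] sub by (simp add: Int_absorb1)
  show "continuous_map (subtopology S U) euclidean \<phi>"
    using homeomorphic_imp_continuous_map[OF hom] continuous_map_in_subtopology by blast
  show "\<exists>T. open T \<and> \<phi> ` U = T \<inter> half_plane"
    using assms by (auto simp: surface_chart_def openin_open)
qed

lemma translator_continuous_map:
  assumes "translator S A F"
  shows "continuous_map S euclidean F"
proof -
  have imm: "smooth_immersion S A F" using assms by (simp add: translator_def)
  then have surf: "smooth_surface S A" by (simp add: smooth_immersion_def)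
  have "continuous_map (subtopology S U) euclidean F" if "(U, \<phi>) \<in> A" for U \<phi>
  proof -
    have chart: "surface_chart S U \<phi>" using surf that by (auto simp: smooth_surface_def)
    note c = surface_chart_facts[OF chart]
    have "smooth_on (F \<circ> inv_into U \<phi>) (\<phi> ` U)"
      using imm that by (auto simp: smooth_immersion_def)
    then have "Ck_on 0 (F \<circ> inv_into U \<phi>) (\<phi> ` U)" unfolding smooth_on_def by blast
    then have "continuous_map (top_of_set (\<phi> ` U)) euclidean (F \<circ> inv_into U \<phi>)" by simp
    moreover have "continuous_map (subtopology S U) (top_of_set (\<phi> ` U)) \<phi>"
      using c(4) by (auto simp: continuous_map_in_subtopology)
    ultimately have "continuous_map (subtopology S U) euclidean ((F \<circ> inv_into U \<phi>) \<circ> \<phi>)"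
      using continuous_map_compose by blast
    then show ?thesis
      by (rule continuous_map_eq) (use c(3) in auto)
  qed
  moreover have "openin S U" if "(U, \<phi>) \<in> A" for U \<phi>
    using surf that surface_chart_facts(1) by (fastforce simp: smooth_surface_def)
  moreover have "\<exists>a\<in>A. x \<in> fst a" if "x \<in> topspace S" for x
    using surf that unfolding smooth_surface_def by force
  ultimately show ?thesis
    by (intro pasting_lemma[of A S fst _ "\<lambda>_. F"]) (auto, force)
qed

text \<open>Away from the surface boundary a chart maps into the open half plane, where the chart
  domain is open in the plane and the local result applies.\<close>

lemma translator_no_local_max:
  fixes \<Phi> :: "complex \<times> real \<Rightarrow> real"
  assumes tr: "translator S A F"
    and x: "x \<in> topspace S" "x \<notin> surface_boundary S"
    and G: "open G" "F x \<in> G"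
    and \<Phi>1: "\<And>q. q \<in> G \<Longrightarrow> (\<Phi> has_derivative (\<lambda>v. \<nu> q \<bullet> v)) (at q)"
    and \<Phi>2: "(\<nu> has_derivative \<nu>') (at (F x))"
    and hess: "\<And>v. \<nu>' v \<bullet> v - \<nu> (F x) \<bullet> HxR_christoffel (F x) v v \<ge> - k * HxR_metric (F x) v v"
    and k: "0 \<le> k" "2 * k < snd (\<nu> (F x))"
    and max: "\<And>y. y \<in> topspace S \<Longrightarrow> F y \<in> G \<Longrightarrow> \<Phi> (F y) \<le> \<Phi> (F x)"
  shows False
proof -
  have imm: "smooth_immersion S A F" using tr by (simp add: translator_def)
  then have surf: "smooth_surface S A" by (simp add: smooth_immersion_def)
  have "x \<in> (\<Union>(U, \<phi>)\<in>A. U)" using surf x(1) by (simp add: smooth_surface_def)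
  then obtain U \<phi> where U: "(U, \<phi>) \<in> A" "x \<in> U" by blast
  have chart: "surface_chart S U \<phi>" using surf U by (auto simp: smooth_surface_def)
  note c = surface_chart_facts[OF chart]
  define D where "D = \<phi> ` U"
  define X where "X = F \<circ> inv_into U \<phi>"
  obtain T where T: "open T" "D = T \<inter> half_plane" using c(5) by (auto simp: D_def)
  have uD: "\<phi> x \<in> D" using U by (simp add: D_def)
  have Xu: "X (\<phi> x) = F x" using c(3) U by (simp add: X_def)
  \<comment> \<open>A chart sending \<open>x\<close> to the boundary line would make
    \<open>x\<close> a point of \<open>surface_boundary S\<close>.\<close>
  have "snd (\<phi> x) \<noteq> 0" using x chart U(2) by (auto simp: surface_boundary_def)
  then have upos: "0 < snd (\<phi> x)" using uD T by (auto simp: half_plane_def)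
  have smooth: "smooth_on X D" and inj: "inj (frechet_derivative X (at (\<phi> x) within D))"
    using imm U uD by (auto simp: smooth_immersion_def X_def D_def)
  have "Ck_on 0 X D" using smooth unfolding smooth_on_def by blast
  then have contX: "continuous_on D X" by simp
  have "open {w :: real \<times> real. 0 < snd w}"
    by (intro open_Collect_less continuous_intros)
  then have W0: "open (T \<inter> {w. 0 < snd w})" using T by blast
  have W0D: "T \<inter> {w. 0 < snd w} \<subseteq> D" using T by (auto simp: half_plane_def)
  define W where "W = (T \<inter> {w. 0 < snd w}) \<inter> X -` G"
  have W: "open W"
    unfolding W_def using continuous_on_subset[OF contX W0D] W0 G(1) by (rule continuous_open_preimage)
  show False
  proof (rule immersed_translator_no_local_max[where X = X and D = D and \<Phi> = \<Phi> and \<nu> = \<nu>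
        and \<nu>' = \<nu>' and k = k and G = G and u = "\<phi> x", OF W])
    show "\<phi> x \<in> W" using uD T upos G Xu by (auto simp: W_def)
    show "W \<subseteq> D" using W0D by (auto simp: W_def)
    show "Ck_on 2 X D" using smooth by (simp add: smooth_on_def)
    show "inj (frechet_derivative X (at (\<phi> x) within D))" by fact
    show "X (\<phi> x) \<in> HxR" using tr x by (auto simp: Xu translator_def)
    show "mean_curvature D X (\<phi> x) N = HxR_metric (X (\<phi> x)) N (0, 1)"
      if "is_unit_normal D X (\<phi> x) N" for N
      using tr U(1) uD that unfolding translator_def D_def X_def by blast
    show "X ` W \<subseteq> G" by (auto simp: W_def)
    show "\<Phi> (X w) \<le> \<Phi> (X (\<phi> x))" if "w \<in> W" for w
    proof -
      have "w \<in> \<phi> ` U" using that W0D by (auto simp: W_def D_def)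
      then have "inv_into U \<phi> w \<in> topspace S" using subsetD[OF c(2) inv_into_into] by simp
      moreover have "F (inv_into U \<phi> w) \<in> G" using that by (simp add: W_def X_def)
      ultimately show ?thesis using max[of "inv_into U \<phi> w"] unfolding Xu by (simp add: X_def)
    qed
    show "(\<Phi> has_derivative (\<lambda>v. \<nu> q \<bullet> v)) (at q)" if "q \<in> G" for q
      using \<Phi>1[OF that] .
    show "(\<nu> has_derivative \<nu>') (at (X (\<phi> x)))" unfolding Xu by (rule \<Phi>2)
    show "- k * HxR_metric (X (\<phi> x)) v v
        \<le> \<nu>' v \<bullet> v - \<nu> (X (\<phi> x)) \<bullet> HxR_christoffel (X (\<phi> x)) v v" for v
      unfolding Xu by (rule hess)
    show "2 * k < snd (\<nu> (X (\<phi> x)))" unfolding Xu by (rule k)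
  qed (rule k)
qed


section \<open>Barriers at ideal points\<close>

text \<open>On \<open>norm (fst q - p) = \<delta>\<close> the quadratic penalty is exactly
  \<open>1 / 32\<close>, the bound on the height steps taken later. For positive \<open>s\<close>
  the logarithm tends to minus infinity at the ideal circle.\<close>

definition barrier :: "complex \<Rightarrow> real \<Rightarrow> real \<Rightarrow> complex \<times> real \<Rightarrow> real" where
  "barrier p \<delta> s q = snd q - 1 / (32 * \<delta>\<^sup>2) * (norm (fst q - p))\<^sup>2 + s * ln (1 - (norm (fst q))\<^sup>2)"

definition barrier_grad :: "complex \<Rightarrow> real \<Rightarrow> real \<Rightarrow> complex \<times> real \<Rightarrow> complex \<times> real" where
  "barrier_grad p \<delta> s q =
     (- (1 / (16 * \<delta>\<^sup>2)) *\<^sub>R (fst q - p) - (s * (2 / (1 - (norm (fst q))\<^sup>2))) *\<^sub>R fst q, 1)"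

lemma barrier_has_derivative:
  assumes "q \<in> HxR"
  shows "(barrier p \<delta> s has_derivative (\<lambda>v. barrier_grad p \<delta> s q \<bullet> v)) (at q)"
proof -
  have pos: "0 < 1 - fst q \<bullet> fst q"
    using HxR_one_minus_norm_pos[OF assms] by (simp add: power2_norm_eq_inner)
  show ?thesis
    unfolding barrier_def power2_norm_eq_inner
    apply (rule has_derivative_eq_rhs)
     apply (rule derivative_eq_intros refl pos | simp)+
    apply (rule ext)
    using pos
    apply (simp add: barrier_grad_def power2_norm_eq_inner inner_prod_def inner_diff_left
        inner_diff_right inner_commute)
    apply (simp add: divide_simps)
    done
qed

text \<open>The conformal factor satisfies \<open>dl(v) = l\<^sup>2 * (z \<bullet> v)\<close>, the
  source of the last term.\<close>

lemma barrier_grad_has_derivative: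
  assumes "q \<in> HxR"
  shows "(barrier_grad p \<delta> s has_derivative
    (\<lambda>v. let l = 2 / (1 - (norm (fst q))\<^sup>2) in
       (- (1 / (16 * \<delta>\<^sup>2)) *\<^sub>R fst v - (s * l) *\<^sub>R fst v - (s * l\<^sup>2 * (fst q \<bullet> fst v)) *\<^sub>R fst q, 0))) (at q)"
proof -
  have pos: "1 - fst q \<bullet> fst q \<noteq> 0"
    using HxR_one_minus_norm_pos[OF assms] by (simp add: power2_norm_eq_inner)
  show ?thesis
    unfolding barrier_grad_def power2_norm_eq_inner Let_def
    apply (rule has_derivative_eq_rhs)
     apply (rule derivative_eq_intros refl pos | simp add: pos)+
    apply (rule ext)
    using pos
    apply (simp add: inner_commute power2_eq_square)
    apply (simp add: divide_simps)
    done
qed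

text \<open>Near \<open>p\<close> the conformal factor \<open>l\<close> satisfies \<open>l \<delta> \<ge> 1\<close>, so the factors \<open>1 / \<delta>\<^sup>2\<close> are absorbed by
  the metric.\<close>

lemma barrier_hessian_lower_bound:
  assumes q: "q \<in> HxR" and p: "norm p = 1" and \<delta>: "norm (fst q - p) \<le> \<delta>"
    and s: "0 \<le> s" "s \<le> 1 / 16"
  shows "(let l = 2 / (1 - (norm (fst q))\<^sup>2) in
       (- (1 / (16 * \<delta>\<^sup>2)) *\<^sub>R fst v - (s * l) *\<^sub>R fst v - (s * l\<^sup>2 * (fst q \<bullet> fst v)) *\<^sub>R fst q, 0 :: real)) \<bullet> v
     - barrier_grad p \<delta> s q \<bullet> HxR_christoffel q v v \<ge> - (3/8) * HxR_metric q v v"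
proof -
  define z a l where "z = fst q" and "a = fst v" and "l = 2 / (1 - (norm z)\<^sup>2)"
  have nz: "norm z < 1" using q by (auto simp: HxR_def z_def)
  have pos: "0 < 1 - (norm z)\<^sup>2" using HxR_one_minus_norm_pos[OF q] by (simp add: z_def)
  have l2: "2 \<le> l" using pos by (simp add: l_def divide_simps)
  \<comment> \<open>As \<open>p\<close> lies on the unit circle, \<open>1 - norm z\<close> is at
    most \<delta>, and \<open>1 + norm z\<close> is at most \<open>2\<close>.\<close>
  have ld: "1 \<le> l * \<delta>"
  proof -
    have "1 - norm z \<le> \<delta>"
      using norm_triangle_ineq2[of p z] p \<delta> by (simp add: z_def norm_minus_commute)
    then have "(1 - norm z) * (1 + norm z) \<le> \<delta> * 2"
      using nz by (intro mult_mono) auto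
    then have "1 - (norm z)\<^sup>2 \<le> 2 * \<delta>" by (simp add: power2_eq_square algebra_simps)
    then show ?thesis using pos by (simp add: l_def divide_simps)
  qed
  then have \<delta>pos: "0 < \<delta>" using l2 by (smt (verit) mult_nonneg_nonpos)
  have id: "1 / \<delta> \<le> l" using ld \<delta>pos by (simp add: divide_simps mult.commute)
  have id2: "1 / \<delta>\<^sup>2 \<le> l\<^sup>2"
    using power_mono[OF id, of 2] \<delta>pos by (simp add: power_divide)
  \<comment> \<open>The pairing of \<open>z - p\<close> with the Christoffel direction
    \<open>2 (z \<bullet> a) a - (norm a)\<^sup>2 z\<close>; both summands carry a factor
    \<open>z - p\<close>, hence the gain of \<delta>.\<close>
  define Y where "Y = 2 * (z \<bullet> a) * ((z - p) \<bullet> a) - (norm a)\<^sup>2 * ((z - p) \<bullet> z)"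
  have Y: "\<bar>Y\<bar> \<le> 3 * \<delta> * (norm a)\<^sup>2"
  proof -
    have 1: "\<bar>z \<bullet> a\<bar> \<le> norm a"
      using Cauchy_Schwarz_ineq2[of z a] nz mult_right_mono[of "norm z" 1 "norm a"] by simp
    have 2: "\<bar>(z - p) \<bullet> a\<bar> \<le> \<delta> * norm a"
      using Cauchy_Schwarz_ineq2[of "z - p" a] \<delta> mult_right_mono[of "norm (z - p)" \<delta> "norm a"]
      by (simp add: z_def)
    have 3: "\<bar>(z - p) \<bullet> z\<bar> \<le> \<delta>"
      using Cauchy_Schwarz_ineq2[of "z - p" z] \<delta> nz mult_mono[of "norm (z - p)" \<delta> "norm z" 1] \<delta>pos
      by (simp add: z_def)
    have "\<bar>(z \<bullet> a) * ((z - p) \<bullet> a)\<bar> \<le> norm a * (\<delta> * norm a)"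
      unfolding abs_mult using 1 2 by (intro mult_mono) auto
    moreover have "\<bar>(norm a)\<^sup>2 * ((z - p) \<bullet> z)\<bar> \<le> (norm a)\<^sup>2 * \<delta>"
      unfolding abs_mult using 3 by (simp add: mult_left_mono)
    ultimately show ?thesis by (simp add: Y_def power2_eq_square abs_le_iff algebra_simps)
  qed
  \<comment> \<open>The budget in units of \<open>l\<^sup>2 * (norm a)\<^sup>2\<close>: the four
    error terms cost \<open>1/16\<close>, \<open>3/16\<close>, \<open>1/16\<close> and
    \<open>1/16\<close>, together \<open>3/8\<close>. The term in \<open>t5\<close> has the
    favourable sign.\<close>
  have t1: "1 / (16 * \<delta>\<^sup>2) * (norm a)\<^sup>2 \<le> l\<^sup>2 * (norm a)\<^sup>2 / 16"
    using mult_right_mono[OF id2, of "(norm a)\<^sup>2"] by simp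
  have t2: "\<bar>l / (16 * \<delta>\<^sup>2) * Y\<bar> \<le> 3 * l\<^sup>2 * (norm a)\<^sup>2 / 16"
  proof -
    have "\<bar>l / (16 * \<delta>\<^sup>2) * Y\<bar> = l / (16 * \<delta>\<^sup>2) * \<bar>Y\<bar>" using l2 by (simp add: abs_mult)
    also have "\<dots> \<le> l / (16 * \<delta>\<^sup>2) * (3 * \<delta> * (norm a)\<^sup>2)"
      using Y l2 by (intro mult_left_mono) auto
    also have "\<dots> = (3 * l * (norm a)\<^sup>2 / 16) * (1 / \<delta>)" using \<delta>pos by (simp add: power2_eq_square)
    also have "\<dots> \<le> (3 * l * (norm a)\<^sup>2 / 16) * l"
      using id l2 by (intro mult_left_mono) auto
    finally show ?thesis by (simp add: power2_eq_square algebra_simps)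
  qed
  have t3: "s * l * (norm a)\<^sup>2 \<le> l\<^sup>2 * (norm a)\<^sup>2 / 16"
  proof -
    have "s * l \<le> (1 / 16) * (l * l)"
      using s l2 mult_mono[of s "1/16" l "l * l"] by simp
    then show ?thesis using mult_right_mono[of "s * l" "(1 / 16) * (l * l)" "(norm a)\<^sup>2"]
      by (simp add: power2_eq_square)
  qed
  have t4: "s * l\<^sup>2 * ((norm a)\<^sup>2 * (norm z)\<^sup>2) \<le> l\<^sup>2 * (norm a)\<^sup>2 / 16"
  proof -
    have "s * ((norm a)\<^sup>2 * (norm z)\<^sup>2) \<le> (1 / 16) * ((norm a)\<^sup>2 * 1)"
      using s pos by (intro mult_mono) auto
    then show ?thesis using mult_left_mono[of _ _ "l\<^sup>2"] by (fastforce simp: algebra_simps)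
  qed
  have t5: "0 \<le> s * l\<^sup>2 * (z \<bullet> a)\<^sup>2" using s by simp
  have chr: "HxR_christoffel q v v = (l *\<^sub>R ((2 * (z \<bullet> a)) *\<^sub>R a - ((norm a)\<^sup>2) *\<^sub>R z), 0)"
    by (simp add: HxR_christoffel_def Let_def l_def z_def a_def power2_norm_eq_inner
        scaleR_2 flip: scaleR_scaleR)
  have grad: "barrier_grad p \<delta> s q = (- (1 / (16 * \<delta>\<^sup>2)) *\<^sub>R (z - p) - (s * l) *\<^sub>R z, 1)"
    by (simp add: barrier_grad_def z_def l_def)
  have "barrier_grad p \<delta> s q \<bullet> HxR_christoffel q v v =
      - (l / (16 * \<delta>\<^sup>2) * Y) - 2 * (s * l\<^sup>2 * (z \<bullet> a)\<^sup>2)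
      + s * l\<^sup>2 * ((norm a)\<^sup>2 * (norm z)\<^sup>2)"
    unfolding chr grad
    by (simp add: Y_def inner_prod_def inner_diff_left inner_diff_right inner_commute power2_norm_eq_inner)
      (simp add: power2_eq_square algebra_simps add_divide_distrib diff_divide_distrib)
  moreover have "(let l = 2 / (1 - (norm (fst q))\<^sup>2) in
       (- (1 / (16 * \<delta>\<^sup>2)) *\<^sub>R fst v - (s * l) *\<^sub>R fst v - (s * l\<^sup>2 * (fst q \<bullet> fst v)) *\<^sub>R fst q, 0 :: real)) \<bullet> v
     = - (1 / (16 * \<delta>\<^sup>2) * (norm a)\<^sup>2) - s * l * (norm a)\<^sup>2 - s * l\<^sup>2 * (z \<bullet> a)\<^sup>2"
    unfolding Let_def l_def z_def a_def
    by (simp add: inner_prod_def inner_diff_left dot_square_norm)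
      (simp add: power2_eq_square[of "fst q \<bullet> fst v"])
  moreover have "HxR_metric q v v = l\<^sup>2 * (norm a)\<^sup>2 + (snd v)\<^sup>2"
    by (simp add: HxR_metric_def l_def z_def a_def dot_square_norm power2_eq_square[of "snd v"])
  ultimately show ?thesis
    using t1 t2 t3 t4 t5 zero_le_power2[of "snd v"]
    by (simp only: abs_le_iff) argo
qed

section \<open>Upward propagation of the vertical asymptotic boundary\<close>

text \<open>At finite heights convergence in the compactification is Euclidean convergence, so the
  ordinary closure can be used from here on.\<close>

lemma vertical_asymptotic_boundary_eq_closure:
  "vertical_asymptotic_boundary M = vertical_boundary \<inter> closure M"
proof -
  have "(\<lambda>n. ext (s n)) \<longlonglongrightarrow> ext q \<longleftrightarrow> s \<longlonglongrightarrow> q" for s :: "nat \<Rightarrow> complex \<times> real" and q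
  proof
    assume "(\<lambda>n. ext (s n)) \<longlonglongrightarrow> ext q"
    from tendsto_fst[OF this] tendsto_snd[OF this]
    have "(\<lambda>n. (fst (s n), snd (s n))) \<longlonglongrightarrow> (fst q, snd q)"
      by (intro tendsto_Pair) (auto simp: ext_def)
    then show "s \<longlonglongrightarrow> q" by simp
  next
    assume "s \<longlonglongrightarrow> q"
    then show "(\<lambda>n. ext (s n)) \<longlonglongrightarrow> ext q"
      unfolding ext_def by (intro tendsto_Pair tendsto_ereal tendsto_fst tendsto_snd)
  qed
  moreover have "ext q \<in> ideal_points" if "q \<in> vertical_boundary" for q
    using that by (auto simp: vertical_boundary_def ideal_points_def ext_def HxR_def)
  ultimately show ?thesis
    unfolding vertical_asymptotic_boundary_def asymptotic_boundary_def
    by (intro set_eqI) (simp add: closure_sequential, blast)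
qed

text \<open>Otherwise the barrier has an interior maximum on the surface inside the cylinder of
  radius \<delta> about \<open>p\<close> below height \<open>t + \<epsilon>\<close>. The surface
  misses the top face, the quadratic penalty excludes the side, and the logarithm excludes the ideal
  face.\<close>

lemma vertical_asymptotic_boundary_step:
  assumes M: "properly_immersed_translator S A F"
    and bdry: "compactin S (surface_boundary S)"
    and pt: "(p, t) \<in> vertical_asymptotic_boundary (F ` topspace S)"
    and \<epsilon>: "0 < \<epsilon>" "\<epsilon> < 1 / 32"
  shows "(p, t + \<epsilon>) \<in> vertical_asymptotic_boundary (F ` topspace S)"
proof (rule ccontr)
  define \<Sigma> where "\<Sigma> = F ` topspace S"
  assume "(p, t + \<epsilon>) \<notin> vertical_asymptotic_boundary (F ` topspace S)"
  then have far: "(p, t + \<epsilon>) \<notin> closure \<Sigma>" and cl: "(p, t) \<in> closure \<Sigma>" and p: "norm p = 1"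
    using pt by (auto simp: vertical_asymptotic_boundary_eq_closure vertical_boundary_def \<Sigma>_def)
  have tr: "translator S A F" and pm: "proper_map S (top_of_set HxR) F"
    using M by (auto simp: properly_immersed_translator_def)
  have \<Sigma>H: "\<Sigma> \<subseteq> HxR" using tr by (simp add: translator_def \<Sigma>_def)
  have "closedin (top_of_set HxR) \<Sigma>"
    using pm closed_map_def unfolding proper_map_def \<Sigma>_def by blast
  then obtain T where T: "closed T" "\<Sigma> = HxR \<inter> T" by (auto simp: closedin_closed)
  define B where "B = F ` surface_boundary S"
  have bS: "surface_boundary S \<subseteq> topspace S" by (auto simp: surface_boundary_def)
  have "compactin euclidean B"
    unfolding B_def by (rule image_compactin[OF bdry translator_continuous_map[OF tr]])
  then have B: "compact B" by simp
  have BH: "B \<subseteq> HxR" using \<Sigma>H bS by (auto simp: B_def \<Sigma>_def)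
  \<comment> \<open>The compact image of the boundary projects to a compact subset of the open disc,
    so it stays away from the ideal point \<open>p\<close>.\<close>
  have "compact (fst ` B)" using B by (intro compact_continuous_image continuous_intros)
  moreover have "p \<notin> fst ` B" using BH p by (auto simp: HxR_def)
  ultimately obtain r1 where r1: "r1 > 0" "ball p r1 \<subseteq> - fst ` B"
    by (metis ComplI compact_imp_closed open_Compl openE)
  obtain r2 where r2: "r2 > 0" "ball (p, t + \<epsilon>) r2 \<subseteq> - closure \<Sigma>"
    using far by (metis ComplI closed_closure open_Compl openE)
  define \<delta> where "\<delta> = min r1 r2 / 2"
  have \<delta>: "0 < \<delta>" "\<delta> < r1" "\<delta> < r2" using r1 r2 by (auto simp: \<delta>_def min_def)
  have offB: "q \<notin> B" if "norm (fst q - p) \<le> \<delta>" for q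
    using r1(2) that \<delta>(2) by (force simp: dist_norm norm_minus_commute)
  have offtop: "snd q \<noteq> t + \<epsilon>" if "q \<in> \<Sigma>" "norm (fst q - p) \<le> \<delta>" for q
  proof
    assume "snd q = t + \<epsilon>"
    then have "q = (fst q, t + \<epsilon>)" by (simp add: prod_eq_iff)
    then have "dist (p, t + \<epsilon>) q = norm (fst q - p)"
      by (metis dist_Pair_Pair dist_norm dist_self norm_minus_commute power_zero_numeral
          real_sqrt_abs abs_norm_cancel add.right_neutral)
    then have "q \<in> ball (p, t + \<epsilon>) r2" using that(2) \<delta>(3) by simp
    then show False using r2(2) that(1) closure_subset[of \<Sigma>] by blast
  qed
  \<comment> \<open>Half the slack in \<open>\<epsilon> < 1 / 32\<close>: on the side of the
    cylinder \<open>f\<close> is at most \<open>t + \<epsilon> - 1 / 32 = t - 2 * \<theta>\<close>,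
    below the level \<open>t - \<theta>\<close>.\<close>
  define \<theta> where "\<theta> = (1 / 32 - \<epsilon>) / 2"
  have \<theta>: "0 < \<theta>" using \<epsilon> by (simp add: \<theta>_def)
  define f where "f = barrier p \<delta> 0"
  have f_eq: "f q = snd q - 1 / (32 * \<delta>\<^sup>2) * (norm (fst q - p))\<^sup>2" for q
    by (simp add: f_def barrier_def)
  \<comment> \<open>Since \<open>f (p, t) = t\<close>, surface points close to \<open>(p, t)\<close>
    lie above the level \<open>t - \<theta>\<close>.\<close>
  have "open {q. norm (fst q - p) < \<delta> \<and> snd q < t + \<epsilon> \<and> t - \<theta> < f q}" (is "open ?O")
    unfolding f_eq by (intro open_Collect_conj open_Collect_less continuous_intros)
  moreover have "(p, t) \<in> ?O" using \<delta> \<epsilon> \<theta> by (simp add: f_eq)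
  ultimately have "?O \<inter> \<Sigma> \<noteq> {}" using cl open_Int_closure_eq_empty by blast
  then obtain q0 where q0: "q0 \<in> \<Sigma>" "norm (fst q0 - p) < \<delta>" "snd q0 < t + \<epsilon>" "t - \<theta> < f q0"
    by auto
  define L where "L = - ln (1 - (norm (fst q0))\<^sup>2)"
  have ln_nonpos: "ln (1 - (norm (fst q))\<^sup>2) \<le> 0" if "q \<in> HxR" for q
    using HxR_one_minus_norm_pos[OF that] by simp
  have L: "0 \<le> L" using ln_nonpos[of q0] q0(1) \<Sigma>H by (auto simp: L_def)
  define m where "m = f q0 - (t - \<theta>)"
  have m: "0 < m" using q0 by (simp add: m_def)
  \<comment> \<open>Chosen after \<open>q0\<close>, so that the logarithm costs \<open>q0\<close>
    less than its surplus \<open>m\<close>; the bound \<open>1 / 16\<close> is the one of the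
    Hessian estimate.\<close>
  define s where "s = min (1 / 16) (m / (2 * (L + 1)))"
  have s: "0 < s" "s \<le> 1 / 16" "s \<le> m / (2 * (L + 1))"
    unfolding s_def using m L by (simp, intro min.cobounded1, intro min.cobounded2)
  have "s * L \<le> m / (2 * (L + 1)) * L" using s L by (intro mult_right_mono) auto
  also have "\<dots> = m * (L / (2 * (L + 1)))" by simp
  also have "\<dots> < m * 1" using m L by (intro mult_strict_left_mono) auto
  finally have sL: "s * L < m" by simp
  define \<Phi> where "\<Phi> = barrier p \<delta> s"
  have \<Phi>_eq: "\<Phi> q = f q + s * ln (1 - (norm (fst q))\<^sup>2)" for q
    by (simp add: \<Phi>_def f_eq barrier_def)
  have \<Phi>q0: "t - \<theta> < \<Phi> q0" using sL by (simp add: \<Phi>_eq L_def m_def)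
  have f_le: "f q \<le> snd q" for q by (simp add: f_eq)
  have \<Phi>_le: "\<Phi> q \<le> f q" if "q \<in> HxR" for q
    using mult_nonneg_nonpos[OF less_imp_le[OF s(1)] ln_nonpos[OF that]] by (simp add: \<Phi>_eq)
  \<comment> \<open>Beyond radius \<rho> the logarithmic term is at most
    \<open>- (\<theta> + \<epsilon>)\<close>, which brings \<Phi> down to
    \<open>t - \<theta>\<close> at all heights up to \<open>t + \<epsilon>\<close>.\<close>
  define \<rho> where "\<rho> = sqrt (1 - exp (- (\<theta> + \<epsilon>) / s))"
  have "exp (- (\<theta> + \<epsilon>) / s) < 1" using \<theta> \<epsilon> s by (simp add: divide_neg_pos)
  then have \<rho>: "0 \<le> \<rho>" "\<rho> < 1" "\<rho>\<^sup>2 = 1 - exp (- (\<theta> + \<epsilon>) / s)"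
    by (auto simp: \<rho>_def)
  define C where "C = {q \<in> cball 0 \<rho> \<times> {t - \<theta>..t + \<epsilon>}. norm (fst q - p) \<le> \<delta>}"
  have inC: "q \<in> C"
    if "q \<in> HxR" "norm (fst q - p) \<le> \<delta>" "snd q \<le> t + \<epsilon>" "t - \<theta> < \<Phi> q" for q
  proof -
    have 1: "t - \<theta> \<le> snd q" using f_le[of q] \<Phi>_le[OF that(1)] that(4) by linarith
    have "norm (fst q) \<le> \<rho>"
    proof (rule ccontr)
      assume "\<not> norm (fst q) \<le> \<rho>"
      then have "\<rho>\<^sup>2 < (norm (fst q))\<^sup>2" using \<rho>(1) by (intro power_strict_mono) auto
      then have "ln (1 - (norm (fst q))\<^sup>2) \<le> ln (exp (- (\<theta> + \<epsilon>) / s))"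
        using \<rho>(3) HxR_one_minus_norm_pos[OF that(1)] by (intro ln_mono) auto
      then have "s * ln (1 - (norm (fst q))\<^sup>2) \<le> s * (- (\<theta> + \<epsilon>) / s)"
        using s by (intro mult_left_mono) auto
      then show False using that(3,4) f_le[of q] s by (simp add: \<Phi>_eq)
    qed
    then show ?thesis using 1 that by (auto simp: C_def mem_Times_iff)
  qed
  have CH: "C \<subseteq> HxR" using \<rho>(2) by (auto simp: C_def HxR_def)
  have "closed {q :: complex \<times> real. norm (fst q - p) \<le> \<delta>}"
    by (intro closed_Collect_le continuous_intros)
  then have "compact (cball 0 \<rho> \<times> {t - \<theta>..t + \<epsilon>} \<inter> {q. norm (fst q - p) \<le> \<delta>})"
    by (intro compact_Int_closed compact_Times) auto
  moreover have "C = cball 0 \<rho> \<times> {t - \<theta>..t + \<epsilon>} \<inter> {q. norm (fst q - p) \<le> \<delta>}"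
    unfolding C_def by blast
  ultimately have "compact C" by simp
  then have "compact (C \<inter> T)" using T by (intro compact_Int_closed)
  \<comment> \<open>\<open>C\<close> lies inside \<open>HxR\<close>, where properness makes the
    surface relatively closed; so its part in \<open>C\<close> is compact.\<close>
  moreover have CT: "C \<inter> T = C \<inter> \<Sigma>" using CH T by auto
  moreover have "q0 \<in> C \<inter> \<Sigma>" using inC[of q0] q0 \<Phi>q0 \<Sigma>H by auto
  moreover have "continuous_on (C \<inter> \<Sigma>) \<Phi>"
    using CH barrier_has_derivative[of _ p \<delta> s] unfolding \<Phi>_def
    by (intro continuous_at_imp_continuous_on ballI has_derivative_continuous) blast
  ultimately have "\<exists>q\<in>C \<inter> \<Sigma>. \<forall>y\<in>C \<inter> \<Sigma>. \<Phi> y \<le> \<Phi> q"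
    by (intro continuous_attains_sup) auto
  then obtain q where q: "q \<in> C" "q \<in> \<Sigma>" "\<And>y. y \<in> C \<Longrightarrow> y \<in> \<Sigma> \<Longrightarrow> \<Phi> y \<le> \<Phi> q"
    by blast
  have \<Phi>q: "t - \<theta> < \<Phi> q" using q(3)[of q0] \<open>q0 \<in> C \<inter> \<Sigma>\<close> \<Phi>q0 by auto
  have qH: "q \<in> HxR" using q \<Sigma>H by auto
  have qd: "norm (fst q - p) \<le> \<delta>" and qt: "snd q \<le> t + \<epsilon>" using q(1) by (auto simp: C_def)
  have qt': "snd q < t + \<epsilon>" using offtop[OF q(2) qd] qt by linarith
  have qd': "norm (fst q - p) < \<delta>"
  proof (rule ccontr)
    assume "\<not> norm (fst q - p) < \<delta>"
    then have "norm (fst q - p) = \<delta>" using qd by linarith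
    then have "f q = snd q - 1 / 32" using \<delta> by (simp add: f_eq)
    then show False using \<Phi>q \<Phi>_le[OF qH] qt \<epsilon> by (simp add: \<theta>_def field_simps)
  qed
  obtain x where x: "x \<in> topspace S" "F x = q" using q(2) by (auto simp: \<Sigma>_def)
  define G where "G = HxR \<inter> {q. norm (fst q - p) < \<delta> \<and> snd q < t + \<epsilon>}"
  \<comment> \<open>Here \<open>2 * (3 / 8)\<close> is less than \<open>1\<close>, the vertical
    derivative of the barrier.\<close>
  show False
  proof (rule translator_no_local_max[where \<Phi> = \<Phi> and G = G and \<nu> = "barrier_grad p \<delta> s"
        and k = "3 / 8", OF tr x(1)])
    show "x \<notin> surface_boundary S" using offB[OF qd] x by (auto simp: B_def)
    have "open HxR" by (simp add: HxR_def open_Times)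
    then show "open G"
      unfolding G_def by (intro open_Int open_Collect_conj open_Collect_less continuous_intros)
    show "F x \<in> G" using qd' qt' qH x by (simp add: G_def)
    show "(\<Phi> has_derivative (\<lambda>v. barrier_grad p \<delta> s q \<bullet> v)) (at q)" if "q \<in> G" for q
      using barrier_has_derivative[of q p \<delta> s] that by (simp add: \<Phi>_def G_def)
    show "(barrier_grad p \<delta> s has_derivative
      (\<lambda>v. let l = 2 / (1 - (norm (fst (F x)))\<^sup>2) in
       (- (1 / (16 * \<delta>\<^sup>2)) *\<^sub>R fst v - (s * l) *\<^sub>R fst v - (s * l\<^sup>2 * (fst (F x) \<bullet> fst v)) *\<^sub>R fst (F x), 0)))
      (at (F x))"
      using barrier_grad_has_derivative qH x by blast
    show "- (3 / 8) * HxR_metric (F x) v v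
      \<le> (let l = 2 / (1 - (norm (fst (F x)))\<^sup>2) in
       (- (1 / (16 * \<delta>\<^sup>2)) *\<^sub>R fst v - (s * l) *\<^sub>R fst v - (s * l\<^sup>2 * (fst (F x) \<bullet> fst v)) *\<^sub>R fst (F x), 0)) \<bullet> v
        - barrier_grad p \<delta> s (F x) \<bullet> HxR_christoffel (F x) v v" for v
      using barrier_hessian_lower_bound[of "F x" p \<delta> s v] qH x p qd s by simp
    show "2 * (3 / 8) < snd (barrier_grad p \<delta> s (F x))" by (simp add: barrier_grad_def)
    \<comment> \<open>Competitors above the level \<open>t - \<theta>\<close> lie in
      \<open>C\<close>; all others are below the value at \<open>q\<close>.\<close>
    show "\<Phi> (F y) \<le> \<Phi> (F x)" if "y \<in> topspace S" "F y \<in> G" for y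
    proof (cases "t - \<theta> < \<Phi> (F y)")
      case True
      then have "F y \<in> C" using that inC[of "F y"] by (auto simp: G_def)
      then show ?thesis using q(3) that x by (simp add: \<Sigma>_def)
    next
      case False
      then show ?thesis using \<Phi>q x by simp
    qed
  qed simp
qed

text \<open>The bound on the step is the same at every height, so finitely many equal steps reach
  \<open>t'\<close>.\<close>

lemma vertical_asymptotic_boundary_upward_closed:
  assumes "properly_immersed_translator S A F" "compactin S (surface_boundary S)"
    and pt: "(p, t) \<in> vertical_asymptotic_boundary (F ` topspace S)" and le: "t \<le> t'"
  shows "(p, t') \<in> vertical_asymptotic_boundary (F ` topspace S)"
proof (cases "t = t'")
  case False
  then have lt: "t < t'" using le by simp
  \<comment> \<open>The factor \<open>64\<close> makes each step at most
    \<open>1 / 64\<close>.\<close>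
  define n where "n = nat \<lceil>64 * (t' - t)\<rceil>"
  have n: "64 * (t' - t) \<le> real n" by (simp add: n_def real_nat_ceiling_ge)
  have "0 < 64 * (t' - t)" using lt by simp
  then have n0: "0 < real n" using n by (rule less_le_trans)
  define \<epsilon> where "\<epsilon> = (t' - t) / real n"
  have \<epsilon>: "0 < \<epsilon>" "\<epsilon> < 1 / 32" using n n0 lt by (auto simp: \<epsilon>_def field_simps)
  have "(p, t + real k * \<epsilon>) \<in> vertical_asymptotic_boundary (F ` topspace S)" for k
  proof (induction k)
    case (Suc k)
    from vertical_asymptotic_boundary_step[OF assms(1,2) this \<epsilon>]
    show ?case by (simp add: algebra_simps)
  qed (use pt in simp)
  from this[of n] show ?thesis using n0 by (simp add: \<epsilon>_def)
qed (use pt in simp)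


section \<open>Families of immersed curves\<close>

text \<open>\<open>L\<close> may be any compact set of reals, so singletons and injective images of
  compact intervals are treated alike.\<close>

definition compact_arc :: "'a::topological_space set \<Rightarrow> bool" where
  "compact_arc D \<longleftrightarrow> (\<exists>(L :: real set) c. compact L \<and> continuous_on L c \<and> inj_on c L \<and> D = c ` L)"

lemma countable_interval_minus_interior:
  fixes I :: "real set"
  assumes "is_interval I"
  shows "countable (I - interior I)"
proof -
  obtain a b where "I = {} \<or> I = UNIV \<or> I = {..<b} \<or> I = {..b} \<or> I = {a<..} \<or> I = {a..} \<or>
    I = {a<..<b} \<or> I = {a<..b} \<or> I = {a..<b} \<or> I = {a..b}"
    using is_real_interval[OF assms] by blast
  then have "I - interior I \<subseteq> {a, b}"
    by (elim disjE) (auto simp: interior_open)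
  then show ?thesis by (rule countable_subset) simp
qed

text \<open>Around each interior parameter, local injectivity gives an interval with rational end
  points on which \<open>c\<close> is injective. The end points of \<open>I\<close> itself enter as
  singletons.\<close>

lemma immersed_curve_countable_union_arcs:
  assumes "immersed_curve C"
  shows "\<exists>\<D>. countable \<D> \<and> \<Union>\<D> = C \<and> (\<forall>D\<in>\<D>. compact_arc D)"
proof -
  obtain I :: "real set" and c where I: "is_interval I" "continuous_on I c" "C = c ` I"
    and inj: "\<And>s. s \<in> I \<Longrightarrow> \<exists>\<epsilon>>0. inj_on c (I \<inter> ball s \<epsilon>)"
    using assms unfolding immersed_curve_def by blast
  define \<L> where "\<L> = {L \<in> (\<lambda>(q, r). {q..r}) ` (\<rat> \<times> \<rat>). L \<subseteq> I \<and> inj_on c L}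
    \<union> (\<lambda>s. {s}) ` (I - interior I)"
  have "countable {L \<in> (\<lambda>(q, r). {q..r :: real}) ` (\<rat> \<times> \<rat>). L \<subseteq> I \<and> inj_on c L}"
    by (rule countable_subset[where B = "(\<lambda>(q, r). {q..r :: real}) ` (\<rat> \<times> \<rat>)"])
      (auto intro!: countable_image countable_SIGMA countable_rat)
  then have "countable \<L>"
    unfolding \<L>_def
    by (intro countable_Un countable_image[OF countable_interval_minus_interior] I)
  have L: "compact L" "L \<subseteq> I" "inj_on c L" if "L \<in> \<L>" for L
    using that by (auto simp: \<L>_def)
  have "I \<subseteq> \<Union>\<L>"
  proof
    fix s assume s: "s \<in> I"
    show "s \<in> \<Union>\<L>"
    proof (cases "s \<in> interior I")
      case True
      obtain \<epsilon> where \<epsilon>: "\<epsilon> > 0" "inj_on c (I \<inter> ball s \<epsilon>)" using inj[OF s] by blast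
      obtain \<eta> where \<eta>: "\<eta> > 0" "ball s \<eta> \<subseteq> I" using True mem_interior by blast
      define d where "d = min \<epsilon> \<eta>"
      have d: "d > 0" using \<epsilon> \<eta> by (simp add: d_def)
      obtain q where q: "q \<in> \<rat>" "s - d < q" "q < s" using Rats_dense_in_real[of "s - d" s] d by auto
      obtain r where r: "r \<in> \<rat>" "s < r" "r < s + d" using Rats_dense_in_real[of s "s + d"] d by auto
      have "{q..r} \<subseteq> ball s d" using q r by (auto simp: dist_real_def)
      moreover have "ball s d \<subseteq> ball s \<eta>" "ball s d \<subseteq> ball s \<epsilon>" by (auto simp: d_def)
      ultimately have "{q..r} \<subseteq> I" "{q..r} \<subseteq> I \<inter> ball s \<epsilon>" using \<eta>(2) by blast+
      then have "{q..r} \<subseteq> I" "inj_on c {q..r}" using \<epsilon>(2) inj_on_subset by blast+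
      then have "{q..r} \<in> \<L>" using q(1) r(1) by (force simp: \<L>_def)
      then show ?thesis using q r by (auto intro!: bexI[of _ "{q..r}"])
    qed (use s in \<open>auto simp: \<L>_def\<close>)
  qed
  then have "\<Union>\<L> = I" using L by blast
  show ?thesis
  proof (intro exI conjI ballI)
    show "countable ((`) c ` \<L>)" using \<open>countable \<L>\<close> by blast
    show "\<Union>((`) c ` \<L>) = C" using \<open>\<Union>\<L> = I\<close> I(3) by blast
    show "compact_arc D" if "D \<in> (`) c ` \<L>" for D
    proof -
      obtain L' where "L' \<in> \<L>" "D = c ` L'" using \<open>D \<in> (`) c ` \<L>\<close> by blast
      then show ?thesis
        using L[of L'] continuous_on_subset[OF I(2), of L'] unfolding compact_arc_def by blast
    qed
  qed
qed

lemma proper_family_countable_union_arcs: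
  assumes "proper_family_of_disjoint_curves \<C>"
  obtains \<D> where "countable \<D>" "\<Union>\<D> = \<Union>\<C>" "\<And>D. D \<in> \<D> \<Longrightarrow> compact_arc D"
proof -
  have C: "immersed_curve C" "C \<subseteq> vertical_boundary" if "C \<in> \<C>" for C
    using assms that by (auto simp: proper_family_of_disjoint_curves_def)
  \<comment> \<open>Compact cylinders exhausting the vertical boundary: each meets finitely many
    curves, and each curve, being nonempty, meets one of them.\<close>
  define K :: "nat \<Rightarrow> (complex \<times> real) set" where "K n = sphere 0 1 \<times> {- real n..real n}" for n
  have fin: "finite {C \<in> \<C>. C \<inter> K n \<noteq> {}}" for n
  proof -
    have "compact (K n)" "K n \<subseteq> vertical_boundary"
      by (auto simp: K_def vertical_boundary_def intro!: compact_Times)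
    then show ?thesis using assms by (simp add: proper_family_of_disjoint_curves_def)
  qed
  have "countable (\<Union>n. {C \<in> \<C>. C \<inter> K n \<noteq> {}})"
    by (rule countable_UN[OF countableI_type countable_finite[OF fin]])
  moreover have "\<C> \<subseteq> (\<Union>n. {C \<in> \<C>. C \<inter> K n \<noteq> {}})"
  proof
    fix C assume "C \<in> \<C>"
    then obtain q where q: "q \<in> C" "q \<in> vertical_boundary"
      using C[of C] unfolding immersed_curve_def by blast
    obtain n where "\<bar>snd q\<bar> \<le> real n" using real_arch_simple by blast
    then have "q \<in> K n"
      using q(2) by (auto simp: K_def vertical_boundary_def abs_le_iff)
    then show "C \<in> (\<Union>n. {C \<in> \<C>. C \<inter> K n \<noteq> {}})" using q \<open>C \<in> \<C>\<close> by blast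
  qed
  ultimately have "countable \<C>" by (rule countable_subset[rotated])
  have "\<exists>\<D>. countable \<D> \<and> \<Union>\<D> = C \<and> (\<forall>D\<in>\<D>. compact_arc D)" if "C \<in> \<C>" for C
    using immersed_curve_countable_union_arcs[OF C(1)[OF that]] .
  then obtain d where d: "\<And>C. C \<in> \<C> \<Longrightarrow> countable (d C) \<and> \<Union>(d C) = C \<and> (\<forall>D\<in>d C. compact_arc D)"
    by metis
  show thesis
  proof (rule that)
    show "countable (\<Union>(d ` \<C>))" using \<open>countable \<C>\<close> d by blast
    have "\<Union>(\<Union>(d ` \<C>)) = (\<Union>C\<in>\<C>. \<Union>(d C))" by blast
    also have "\<dots> = (\<Union>C\<in>\<C>. C)" by (rule SUP_cong) (simp_all add: d)
    finally show "\<Union>(\<Union>(d ` \<C>)) = \<Union>\<C>" by simp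
    show "compact_arc D" if "D \<in> \<Union>(d ` \<C>)" for D
    proof -
      obtain C where "C \<in> \<C>" "D \<in> d C" using \<open>D \<in> \<Union>(d ` \<C>)\<close> by blast
      then show ?thesis using d[of C] by simp
    qed
  qed
qed

section \<open>Dimension and Baire category\<close>

text \<open>Compactness of \<open>L\<close> makes the inverse of \<open>c\<close> continuous, so
  \<open>e\<close> followed by it would embed an open set of dimension at least two into the line,
  against invariance of dimension.\<close>

lemma open_not_into_compact_arc:
  fixes e :: "'a::euclidean_space \<Rightarrow> 'b::t2_space"
  assumes "2 \<le> DIM('a)" "open U" "U \<noteq> {}" "continuous_on U e" "inj_on e U" "compact_arc D"
  shows "\<not> e ` U \<subseteq> D"
proof
  assume sub: "e ` U \<subseteq> D"
  obtain L :: "real set" and c where L: "compact L" "continuous_on L c" "inj_on c L" "D = c ` L"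
    using assms(6) by (auto simp: compact_arc_def)
  have "continuous_on (e ` U) (the_inv_into L c)"
    using continuous_on_inv_into[OF L(2,1,3)] sub L(4) continuous_on_subset by blast
  then have cont: "continuous_on U (the_inv_into L c \<circ> e)"
    using assms(4) continuous_on_compose by blast
  have "inj_on (the_inv_into L c) (e ` U)"
    using inj_on_the_inv_into[OF L(3)] sub L(4) inj_on_subset by blast
  then have "inj_on (the_inv_into L c \<circ> e) U"
    using assms(5) comp_inj_on by blast
  from invariance_of_dimension[OF cont assms(2) this assms(3)] show False
    using assms(1) by simp
qed

text \<open>If no member had interior, the complements would be open and dense, and their
  intersection would meet \<open>U\<close>.\<close>

lemma Baire_countable_closed_cover:
  fixes U :: "'a::{real_normed_vector,heine_borel} set"
  assumes "countable \<K>" "open U" "U \<noteq> {}" "U \<subseteq> \<Union>\<K>" "\<And>K. K \<in> \<K> \<Longrightarrow> closed K"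
  obtains K where "K \<in> \<K>" "interior K \<noteq> {}"
proof -
  have "\<exists>K\<in>\<K>. interior K \<noteq> {}"
  proof (rule ccontr)
    assume *: "\<not> (\<exists>K\<in>\<K>. interior K \<noteq> {})"
    have "UNIV \<subseteq> closure (\<Inter>(uminus ` \<K>))"
    proof (rule Baire)
      show "openin (top_of_set UNIV) T \<and> UNIV \<subseteq> closure T" if "T \<in> uminus ` \<K>" for T
        using that assms(5) * by (auto simp: closure_complement)
    qed (use assms in auto)
    then have "U \<inter> \<Inter>(uminus ` \<K>) \<noteq> {}"
      using open_Int_closure_eq_empty[OF assms(2)] assms(3) by blast
    then show False using assms(4) by blast
  qed
  then show thesis using that by blast
qed

text \<open>The preimages of the arcs in \<open>B\<close> are closed and countably many. If they
  covered \<open>B\<close>, one would contain an open set, which its \<open>e\<close> would map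
  injectively into a compact arc.\<close>

lemma box_not_covered_by_compact_arcs:
  fixes B :: "'a::euclidean_space set" and E :: "('a \<Rightarrow> 'b::t2_space) set"
  assumes dim: "2 \<le> DIM('a)" and B: "closed B" "interior B \<noteq> {}"
    and E: "countable E" "\<And>e. e \<in> E \<Longrightarrow> continuous_on B e" "\<And>e. e \<in> E \<Longrightarrow> inj_on e B"
    and D: "countable \<D>" "\<And>D. D \<in> \<D> \<Longrightarrow> compact_arc D"
  shows "\<exists>x\<in>B. \<forall>e\<in>E. e x \<notin> \<Union>\<D>"
proof (rule ccontr)
  assume *: "\<not> (\<exists>x\<in>B. \<forall>e\<in>E. e x \<notin> \<Union>\<D>)"
  define \<K> where "\<K> = (\<lambda>(e, D). B \<inter> e -` D) ` (E \<times> \<D>)"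
  obtain K where K: "K \<in> \<K>" "interior K \<noteq> {}"
  proof (rule Baire_countable_closed_cover[of \<K> "interior B"])
    show "countable \<K>" using E D by (auto simp: \<K>_def)
    show "interior B \<subseteq> \<Union>\<K>" using * interior_subset[of B] by (fastforce simp: \<K>_def)
    show "closed K" if K: "K \<in> \<K>" for K
    proof -
      obtain e D where e: "e \<in> E" "D \<in> \<D>" "K = B \<inter> e -` D" using K by (auto simp: \<K>_def)
      have "compact D"
        using D(2)[OF e(2)] compact_continuous_image unfolding compact_arc_def by blast
      then show ?thesis
        unfolding e by (intro continuous_closed_preimage E(2) e B compact_imp_closed)
    qed
  qed (use B in auto)
  obtain e D where e: "e \<in> E" "D \<in> \<D>" "K = B \<inter> e -` D" using K by (auto simp: \<K>_def)
  have sub: "interior K \<subseteq> B" "e ` interior K \<subseteq> D" using interior_subset[of K] e(3) by auto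
  have "\<not> e ` interior K \<subseteq> D"
    using open_not_into_compact_arc[OF dim open_interior K(2) continuous_on_subset[OF E(2) sub(1)]
        inj_on_subset[OF E(3) sub(1)]] e D by blast
  then show False using sub by blast
qed

text \<open>Over a nondegenerate arc of the circle, the sets \<open>\<Union>\<C>\<close> and its downward vertical translates
  would cover a rectangle, contradicting Baire's theorem.\<close>

lemma upward_closed_component_projection:
  fixes w :: complex
  assumes fam: "proper_family_of_disjoint_curves \<C>"
    and up: "\<And>p t t'. (p, t) \<in> \<Union>\<C> \<Longrightarrow> t \<le> t' \<Longrightarrow> (p, t') \<in> \<Union>\<C>"
    and \<gamma>: "connected \<gamma>" "\<gamma> \<subseteq> \<Union>\<C>" and w: "norm w = 1"
    and q: "q \<in> \<gamma>" "q' \<in> \<gamma>"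
  shows "Re (cnj w * fst q) = Re (cnj w * fst q')"
proof -
  \<comment> \<open>The coordinate of \<open>fst q\<close> in the direction
    \<open>w\<close>.\<close>
  define P where "P = (\<lambda>q :: complex \<times> real. Re (cnj w * fst q))"
  have False if ab: "a \<in> \<gamma>" "b \<in> \<gamma>" "P a < P b" for a b
  proof -
    obtain \<D> where D: "countable \<D>" "\<Union>\<D> = \<Union>\<C>" "\<And>D. D \<in> \<D> \<Longrightarrow> compact_arc D"
      using proper_family_countable_union_arcs[OF fam] by blast
    have circ: "norm (fst q) = 1" if "q \<in> \<gamma>" for q
    proof -
      obtain C where "C \<in> \<C>" "q \<in> C" using \<open>q \<in> \<gamma>\<close> \<gamma>(2) by blast
      then have "q \<in> vertical_boundary"
        using fam unfolding proper_family_of_disjoint_curves_def by blast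
      then show ?thesis by (auto simp: vertical_boundary_def)
    qed
    have wu: "w * (cnj w * z) = z" for z
      using w by (simp add: mult.assoc[symmetric] complex_norm_square[symmetric])
    have wne: "w \<noteq> 0" using w by auto
    \<comment> \<open>In the frame rotated by \<open>w\<close>, \<sigma> selects one of the two half
      circles as a graph over \<open>x\<close>, and \<open>n\<close> is a vertical shift. A point
      shifted by \<open>n\<close> lies in the family iff the unshifted one lies in its downward
      translate.\<close>
    define e where "e = (\<lambda>(\<sigma>, n) (x, h). (w * Complex x (\<sigma> * sqrt (1 - x\<^sup>2)), h + real n))"
    have "\<exists>x\<in>{P a..P b} \<times> {0..1}. \<forall>f\<in>e ` ({1, -1} \<times> (UNIV :: nat set)). f x \<notin> \<Union>\<D>"
    proof (rule box_not_covered_by_compact_arcs)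
      show "interior ({P a..P b} \<times> {0..1 :: real}) \<noteq> {}"
        using ab(3) by (auto simp: interior_Times)
      show "continuous_on ({P a..P b} \<times> {0..1}) f" if "f \<in> e ` ({1, -1} \<times> UNIV)" for f
        using that by (auto simp: e_def case_prod_unfold Complex_eq intro!: continuous_intros)
      show "inj_on f ({P a..P b} \<times> {0..1})" if "f \<in> e ` ({1, -1} \<times> UNIV)" for f
        using that wne by (auto simp: e_def inj_on_def)
    qed (use D in \<open>auto intro!: closed_Times\<close>)
    then obtain x h where x: "P a \<le> x" "x \<le> P b" and h: "0 \<le> h"
      and out: "\<And>\<sigma> n. \<sigma> \<in> {1, -1} \<Longrightarrow> e (\<sigma>, n) (x, h) \<notin> \<Union>\<C>"
      using D(2) by fastforce
    \<comment> \<open>By connectedness some point of \<gamma> lies over the coordinate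
      \<open>x\<close> found by the Baire argument.\<close>
    have "connected (P ` \<gamma>)"
      unfolding P_def by (intro connected_continuous_image \<gamma>(1) continuous_intros)
    then have "x \<in> P ` \<gamma>" using ab x connectedD_interval[of "P ` \<gamma>" "P a" "P b" x] by auto
    then obtain g where g: "g \<in> \<gamma>" "P g = x" by auto
    define y where "y = cnj w * fst g"
    have "norm y = 1" using circ[OF g(1)] w by (simp add: y_def norm_mult)
    then have "(Re y)\<^sup>2 + (Im y)\<^sup>2 = 1" by (simp add: cmod_def)
    then have im: "(Im y)\<^sup>2 = 1 - x\<^sup>2" using g(2) by (simp add: P_def y_def)
    define \<sigma> :: real where "\<sigma> = (if 0 \<le> Im y then 1 else -1)"
    have "sqrt (1 - x\<^sup>2) = \<bar>Im y\<bar>" by (simp flip: im)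
    then have "Complex x (\<sigma> * sqrt (1 - x\<^sup>2)) = y"
      using g(2) by (simp add: complex_eq_iff P_def y_def \<sigma>_def)
    then have e_eq: "e (\<sigma>, n) (x, h) = (fst g, h + real n)" for n
      by (simp add: e_def y_def wu)
    \<comment> \<open>This shift lifts \<open>h\<close> to at least the height of \<open>g\<close>,
      also for negative \<open>snd g\<close>, where \<open>nat\<close> gives \<open>0\<close>; then
      \<open>up\<close> contradicts \<open>out\<close>.\<close>
    define n where "n = nat \<lceil>snd g\<rceil>"
    have "snd g \<le> h + real n" using h real_nat_ceiling_ge[of "snd g"] by (simp add: n_def)
    moreover have "(fst g, snd g) \<in> \<Union>\<C>" using g(1) \<gamma>(2) by auto
    ultimately have "e (\<sigma>, n) (x, h) \<in> \<Union>\<C>" unfolding e_eq using up by blast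
    then show False using out[of \<sigma> n] by (auto simp: \<sigma>_def split: if_splits)
  qed
  then show ?thesis using q unfolding P_def by (metis linorder_less_linear)
qed

section \<open>Shape of a component\<close>

theorem theorem5:
  fixes M :: "'a topology" and A :: "'a atlas" and F :: "'a \<Rightarrow> complex \<times> real"
    and \<gamma> :: "(complex \<times> real) set" and \<C> :: "(complex \<times> real) set set"
    and M' :: "'b topology" and \<iota> :: "'a \<Rightarrow> 'b" and F' :: "'b \<Rightarrow> complex \<times> ereal"
  assumes "properly_immersed_translator M A F"
    and "compactin M (surface_boundary M)"
    and "proper_family_of_disjoint_curves \<C>"
    and "vertical_asymptotic_boundary (F ` topspace M) = \<Union>\<C>"
    and "\<gamma> \<in> components (vertical_asymptotic_boundary (F ` topspace M))"
    and "surface_with_ideal_boundary_curve M F \<gamma> M' \<iota> F'"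
  shows "\<exists>p\<in>sphere (0::complex) 1. \<gamma> = {p} \<times> UNIV \<or> (\<exists>T::real. \<gamma> = {p} \<times> {T..})"
proof -
  define V where "V = vertical_asymptotic_boundary (F ` topspace M)"
  have up: "(p, t') \<in> V" if "(p, t) \<in> V" "t \<le> t'" for p t t'
    using vertical_asymptotic_boundary_upward_closed[OF assms(1,2)] that by (simp add: V_def)
  have \<gamma>: "\<gamma> \<in> components V" and conn: "connected \<gamma>" and sub: "\<gamma> \<subseteq> V" and ne: "\<gamma> \<noteq> {}"
    using assms(5) in_components_connected[OF assms(5)] in_components_subset[OF assms(5)]
      in_components_nonempty[OF assms(5)] by (simp_all add: V_def)
  have "closed V"
    by (simp add: V_def vertical_asymptotic_boundary_eq_closure vertical_boundary_def
        closed_Int closed_Times)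
  then have cl: "closed \<gamma>" using closed_components[OF _ \<gamma>] by simp
  obtain p t where pt: "(p, t) \<in> \<gamma>" using ne by auto
  have proj: "Re (cnj w * fst q) = Re (cnj w * p)" if "norm w = 1" "q \<in> \<gamma>" for w q
    using upward_closed_component_projection[OF assms(3) _ conn _ that(1) that(2) pt] up sub
    by (simp add: V_def assms(4))
  \<comment> \<open>The directions \<open>1\<close> and \<open>\<i>\<close> recover the real and the
    imaginary part.\<close>
  have fst_eq: "fst q = p" if "q \<in> \<gamma>" for q
    using proj[of 1 q] proj[of \<i> q] that by (simp add: complex_eq_iff)
  define J where "J = {t. (p, t) \<in> \<gamma>}"
  have \<gamma>_eq: "\<gamma> = {p} \<times> J" using fst_eq by (force simp: J_def)
  \<comment> \<open>The vertical segment from \<open>a\<close> to \<open>b\<close> is connected,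
    lies in \<open>V\<close> and meets \<gamma>, so it belongs to the component.\<close>
  have J_up: "b \<in> J" if "a \<in> J" "a \<le> b" for a b
  proof -
    have "{p} \<times> {a..b} \<subseteq> \<gamma>"
    proof (rule components_maximal[OF \<gamma>])
      show "connected ({p} \<times> {a..b})" by (intro connected_Times) auto
      show "{p} \<times> {a..b} \<subseteq> V" using up[of p a] that(1) sub by (auto simp: J_def)
      show "\<gamma> \<inter> ({p} \<times> {a..b}) \<noteq> {}" using that by (auto simp: J_def)
    qed
    then show ?thesis using that by (auto simp: J_def)
  qed
  have J_closed: "closed J"
  proof -
    have "continuous_on UNIV (\<lambda>t :: real. (p, t))" by (intro continuous_intros)
    from closed_vimage[OF cl this] show ?thesis by (simp add: J_def vimage_def)
  qed
  have J_ne: "J \<noteq> {}" using pt by (auto simp: J_def)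
  have p: "p \<in> sphere 0 1"
    using pt sub by (auto simp: V_def vertical_asymptotic_boundary_def vertical_boundary_def)
  show ?thesis
  proof (cases "J = UNIV")
    case True
    then show ?thesis using \<gamma>_eq p by blast
  next
    case False
    \<comment> \<open>By \<open>J_up\<close> a missing height is a lower bound of \<open>J\<close>;
      closedness then puts the infimum into \<open>J\<close>.\<close>
    then obtain a where "a \<notin> J" by blast
    then have "a \<le> t" if "t \<in> J" for t using J_up[OF that] by (meson linear)
    then have bdd: "bdd_below J" by (auto simp: bdd_below_def)
    then have "J = {Inf J..}"
      using closed_contains_Inf[OF J_ne bdd J_closed] J_up cInf_lower by auto
    then show ?thesis using \<gamma>_eq p by blast
  qed
qed

end
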